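(* Let $\equiv$ be a congruence defined by a rewrite system rewriting terms to terms and atomic propositions to propositions, and let $\mathcal M$ be a pre-model of $\equiv$. Consider adding new predicate constants $a_1,\ldots,a_n$ to the language, and extending the congruence by new rewrite rules of the form $a_i\,\vec t\rightsquigarrow B$. Suppose: (1) whenever $(a_i\vec t)\theta\equiv(a_i\vec t')\theta'$, $a_i\vec t\rightsquigarrow B$ and $a_i\vec t'\rightsquigarrow B'$ are new rules, then $B\theta\equiv B'\theta'$; (2) there is a well-founded order $\prec$ (on atomic formulas) such that $a_j\vec t'\prec(a_i\vec t)\theta$ whenever $a_i\vec t\rightsquigarrow B$ is a new rule and $a_j\vec t'$ may occur in $B\theta$. Then there exists a pre-model of the extended congruence in the extended language.
   Context: Formulas: $P ::= \top \mid \bot \mid P\supset Q \mid P\wedge Q \mid P\vee Q \mid \forall x.P \mid \exists x.P \mid t=t' \mid \mu\,B\,\vec t \mid \nu\,B\,\vec t \mid p\,\vec t \mid a\,\vec t$ over simply typed $\lambda$-terms modulo $\beta\eta$ ($o$ the type of propositions, terms of types not containing $o$); $p$ are predicate variables, $a$ predicate constants, $a\vec t$ atomic formulas; $B=\lambda p\lambda\vec x.P$ with $p$ occurring only positively. "$P$ may occur in $Q$" means $P=P'\theta$ where $P'$ occurs in $Q$ and $\theta$ substitutes for variables quantified over in $Q$. Proof terms and reduction (needed only to define candidates): proof terms are built from proof variables and the constructs $\langle\rangle$, $\delta_\bot(\pi)$, $\lambda\alpha.\pi$, $\pi\pi'$, $\langle\pi,\pi'\rangle$, $\mathrm{proj}_i(\pi)$,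 $\mathrm{in}_i(\pi)$, $\delta_\vee$, $\lambda x.\pi$, $\pi t$, $\langle t,\pi\rangle$, $\delta_\exists$, $\mathrm{refl}(t)$, $\delta_=$, $\mu(B,\vec t,\pi)$, $\delta_\mu$, $\nu(\pi,\vec x.\alpha.\pi')$, $\delta_\nu(B,\vec t,\pi)$ of the natural deduction calculus $\mu\mathrm{NJ}$ modulo $\equiv$, with its reduction relation $\to$; $\mathcal{SN}$ is the set of strongly normalizable proof terms; a term is neutral if it is a variable or an elimination construct. A reducibility candidate is a set $R\subseteq\mathcal{SN}$ closed under $\to$ and containing every neutral term whose one-step reducts all lie in $R$; predicate candidates are functions from term tuples to candidates. A pre-model assigns to each predicate constant $a:\gamma_1\to\dots\to\gamma_n\to o$ a function $\hat a$ from tuples of (possibly open) terms of these types to candidates. It induces an interpretation $|P|^{\mathcal E}$ of each formula as a candidate ($\mathcal E$ assigning predicate candidates to free predicate variables) by: $|\bot|=|\top|=|u=v|=\mathcal{SN}$, $|p\vec t|=\mathcal E(p)(\vec t)$, $|a\vec t|=\hat a(\vec t)$, connectives and quantifiers interpreted as sets of $\mathcal{SN}$ terms whose reductions to introduction forms have components in the corresponding interpretations, $|\mu B\vec t|$ and $|\nu B\vec t|$ as least/greatest fixed points of the induced operator on predicate candidates. A pre-model of a congruence is one giving congruent formulas the same interpretation.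
   Formalization: The order ≺ is additionally assumed compatible with the original congruence ≡ (else false: c⇝d with a c⇝(a d⊃⊥)); in "may occur", variables abstracted in fixed-point bodies count as quantified; predicate candidates are taken modulo ≡ on terms. *)

theory Defs
  imports Main
begin

section \<open>Simply typed terms modulo beta-eta\<close>

text \<open>Term types never contain the type of propositions, so only base types (named by
  natural numbers) and arrows are needed.  The term signature is arbitrary: a constant
  \<open>c\<close> with \<open>ctype c = None\<close> is undeclared and occurs in no typed term.\<close>

datatype ty = Base nat | Fun ty ty

class term_signature =
  fixes ctype :: "'a \<Rightarrow> ty option"

text \<open>Every type has its own supply of de Bruijn indices: \<open>Var \<tau> i\<close> is a variable of type
  \<open>\<tau>\<close>, and a binder for type \<open>\<tau>\<close> binds index 0 of \<open>\<tau>\<close>, leaving the indices of all other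
  types alone.  So an open term has a type without reference to a context, and there are
  infinitely many variables of each type.\<close>

datatype 'c trm = Var ty nat | Con 'c | App "'c trm" "'c trm" | Lam ty "'c trm"

fun typeof :: "'c::term_signature trm \<Rightarrow> ty option" where
  "typeof (Var \<tau> i) = Some \<tau>"
| "typeof (Con c) = ctype c"
| "typeof (App s t) =
    (case typeof s of
       Some (Fun \<sigma> \<tau>) \<Rightarrow> if typeof t = Some \<sigma> then Some \<tau> else None
     | _ \<Rightarrow> None)"
| "typeof (Lam \<tau> t) = map_option (Fun \<tau>) (typeof t)"

definition up_ren :: "ty \<Rightarrow> (ty \<Rightarrow> nat \<Rightarrow> nat) \<Rightarrow> ty \<Rightarrow> nat \<Rightarrow> nat" where
  "up_ren \<tau> \<rho> = \<rho>(\<tau> := case_nat 0 (\<lambda>i. Suc (\<rho> \<tau> i)))"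

primrec ren :: "(ty \<Rightarrow> nat \<Rightarrow> nat) \<Rightarrow> 'c trm \<Rightarrow> 'c trm" where
  "ren \<rho> (Var \<tau> i) = Var \<tau> (\<rho> \<tau> i)"
| "ren \<rho> (Con c) = Con c"
| "ren \<rho> (App s t) = App (ren \<rho> s) (ren \<rho> t)"
| "ren \<rho> (Lam \<tau> t) = Lam \<tau> (ren (up_ren \<tau> \<rho>) t)"

definition shift_ren :: "ty list \<Rightarrow> ty \<Rightarrow> nat \<Rightarrow> nat" where
  "shift_ren \<tau>s \<sigma> i = i + count_list \<tau>s \<sigma>"

definition scons_raw :: "ty \<Rightarrow> 'c trm \<Rightarrow> (ty \<Rightarrow> nat \<Rightarrow> 'c trm) \<Rightarrow> ty \<Rightarrow> nat \<Rightarrow> 'c trm" where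
  "scons_raw \<tau> t \<theta> = \<theta>(\<tau> := case_nat t (\<theta> \<tau>))"

definition up_raw :: "ty \<Rightarrow> (ty \<Rightarrow> nat \<Rightarrow> 'c trm) \<Rightarrow> ty \<Rightarrow> nat \<Rightarrow> 'c trm" where
  "up_raw \<tau> \<theta> = scons_raw \<tau> (Var \<tau> 0) (\<lambda>\<sigma> i. ren (shift_ren [\<tau>]) (\<theta> \<sigma> i))"

primrec subst_raw :: "(ty \<Rightarrow> nat \<Rightarrow> 'c trm) \<Rightarrow> 'c trm \<Rightarrow> 'c trm" where
  "subst_raw \<theta> (Var \<tau> i) = \<theta> \<tau> i"
| "subst_raw \<theta> (Con c) = Con c"
| "subst_raw \<theta> (App s t) = App (subst_raw \<theta> s) (subst_raw \<theta> t)"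
| "subst_raw \<theta> (Lam \<tau> t) = Lam \<tau> (subst_raw (up_raw \<tau> \<theta>) t)"

inductive conv :: "'c::term_signature trm \<Rightarrow> 'c trm \<Rightarrow> ty \<Rightarrow> bool" where
  conv_var: "conv (Var \<tau> i) (Var \<tau> i) \<tau>"
| conv_con: "ctype c = Some \<tau> \<Longrightarrow> conv (Con c) (Con c) \<tau>"
| conv_app: "conv s s' (Fun \<sigma> \<tau>) \<Longrightarrow> conv t t' \<sigma> \<Longrightarrow> conv (App s t) (App s' t') \<tau>"
| conv_lam: "conv t t' \<sigma> \<Longrightarrow> conv (Lam \<tau> t) (Lam \<tau> t') (Fun \<tau> \<sigma>)"
| conv_beta: "typeof t = Some \<sigma> \<Longrightarrow> typeof u = Some \<tau> \<Longrightarrow>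
    conv (App (Lam \<tau> t) u) (subst_raw (scons_raw \<tau> u Var) t) \<sigma>"
| conv_eta: "typeof t = Some (Fun \<tau> \<sigma>) \<Longrightarrow>
    conv (Lam \<tau> (App (ren (shift_ren [\<tau>]) t) (Var \<tau> 0))) t (Fun \<tau> \<sigma>)"
| conv_sym: "conv s t \<tau> \<Longrightarrow> conv t s \<tau>"
| conv_trans: "conv s t \<tau> \<Longrightarrow> conv t u \<tau> \<Longrightarrow> conv s u \<tau>"

lemma typeof_ren: "typeof (ren \<rho> t) = typeof t"
  by (induction t arbitrary: \<rho>) (auto split: option.splits ty.splits)

lemma typeof_subst_raw:
  "(\<And>\<sigma> i. typeof (\<theta> \<sigma> i) = Some \<sigma>) \<Longrightarrow> typeof (subst_raw \<theta> t) = typeof t"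
proof (induction t arbitrary: \<theta>)
  case (Lam \<tau> t)
  have "typeof (subst_raw (up_raw \<tau> \<theta>) t) = typeof t"
    by (rule Lam.IH) (auto simp: up_raw_def scons_raw_def typeof_ren Lam.prems split: nat.splits)
  then show ?case by simp
qed (auto split: option.splits ty.splits)

lemma conv_typeof: "conv s t \<tau> \<Longrightarrow> typeof s = Some \<tau> \<and> typeof t = Some \<tau>"
proof (induction rule: conv.induct)
  case (conv_beta t \<sigma> u \<tau>)
  then have "typeof (subst_raw (scons_raw \<tau> u Var) t) = typeof t"
    by (intro typeof_subst_raw) (auto simp: scons_raw_def split: nat.splits)
  with conv_beta show ?case by simp
qed (auto simp: typeof_ren)

lemma conv_refl: "typeof t = Some \<tau> \<Longrightarrow> conv t t \<tau>"
proof (induction t arbitrary: \<tau>)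
  case (App s t)
  then show ?case by (auto split: option.splits ty.splits if_splits intro: conv.intros)
qed (auto intro: conv.intros)

lemma ren_ren: "ren \<rho> (ren \<rho>' t) = ren (\<lambda>\<sigma> i. \<rho> \<sigma> (\<rho>' \<sigma> i)) t"
proof (induction t arbitrary: \<rho> \<rho>')
  case (Lam \<tau> t)
  have "(\<lambda>\<sigma> i. up_ren \<tau> \<rho> \<sigma> (up_ren \<tau> \<rho>' \<sigma> i)) = up_ren \<tau> (\<lambda>\<sigma> i. \<rho> \<sigma> (\<rho>' \<sigma> i))"
    by (auto simp: up_ren_def fun_eq_iff split: nat.splits)
  with Lam show ?case by simp
qed auto

lemma ren_up_shift: "ren (up_ren \<tau> \<rho>) (ren (shift_ren [\<tau>]) t) = ren (shift_ren [\<tau>]) (ren \<rho> t)"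
proof -
  have "(\<lambda>\<sigma> i. up_ren \<tau> \<rho> \<sigma> (shift_ren [\<tau>] \<sigma> i)) = (\<lambda>\<sigma> i. shift_ren [\<tau>] \<sigma> (\<rho> \<sigma> i))"
    by (auto simp: up_ren_def shift_ren_def fun_eq_iff)
  then show ?thesis by (simp add: ren_ren)
qed

lemma subst_raw_ren: "subst_raw \<theta> (ren \<rho> t) = subst_raw (\<lambda>\<sigma> i. \<theta> \<sigma> (\<rho> \<sigma> i)) t"
proof (induction t arbitrary: \<theta> \<rho>)
  case (Lam \<tau> t)
  have "(\<lambda>\<sigma> i. up_raw \<tau> \<theta> \<sigma> (up_ren \<tau> \<rho> \<sigma> i)) = up_raw \<tau> (\<lambda>\<sigma> i. \<theta> \<sigma> (\<rho> \<sigma> i))"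
    by (auto simp: up_ren_def up_raw_def scons_raw_def fun_eq_iff split: nat.splits)
  with Lam show ?case by simp
qed auto

lemma ren_subst_raw: "ren \<rho> (subst_raw \<theta> t) = subst_raw (\<lambda>\<sigma> i. ren \<rho> (\<theta> \<sigma> i)) t"
proof (induction t arbitrary: \<theta> \<rho>)
  case (Lam \<tau> t)
  have "(\<lambda>\<sigma> i. ren (up_ren \<tau> \<rho>) (up_raw \<tau> \<theta> \<sigma> i)) = up_raw \<tau> (\<lambda>\<sigma> i. ren \<rho> (\<theta> \<sigma> i))"
    by (intro ext)
      (simp add: up_raw_def scons_raw_def ren_up_shift split: nat.splits,
       simp add: up_ren_def)
  with Lam show ?case by simp
qed auto

lemma subst_raw_up_shift:
  "subst_raw (up_raw \<tau> \<theta>) (ren (shift_ren [\<tau>]) t) = ren (shift_ren [\<tau>]) (subst_raw \<theta> t)"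
proof -
  have "(\<lambda>\<sigma> i. up_raw \<tau> \<theta> \<sigma> (shift_ren [\<tau>] \<sigma> i)) = (\<lambda>\<sigma> i. ren (shift_ren [\<tau>]) (\<theta> \<sigma> i))"
    by (auto simp: up_raw_def scons_raw_def shift_ren_def fun_eq_iff)
  then show ?thesis by (simp add: subst_raw_ren ren_subst_raw)
qed

lemma subst_raw_Var: "subst_raw Var t = t"
proof (induction t)
  case (Lam \<tau> t)
  have "up_raw \<tau> Var = (Var :: ty \<Rightarrow> nat \<Rightarrow> 'a trm)"
    by (auto simp: up_raw_def scons_raw_def shift_ren_def fun_eq_iff split: nat.splits)
  with Lam show ?case by simp
qed auto

lemma subst_raw_subst_raw:
  "subst_raw \<theta> (subst_raw \<theta>' t) = subst_raw (\<lambda>\<sigma> i. subst_raw \<theta> (\<theta>' \<sigma> i)) t"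
proof (induction t arbitrary: \<theta> \<theta>')
  case (Lam \<tau> t)
  have "(\<lambda>\<sigma> i. subst_raw (up_raw \<tau> \<theta>) (up_raw \<tau> \<theta>' \<sigma> i)) =
      up_raw \<tau> (\<lambda>\<sigma> i. subst_raw \<theta> (\<theta>' \<sigma> i))"
    by (intro ext)
      (simp add: up_raw_def [of _ \<theta>'] up_raw_def [of _ "\<lambda>\<sigma> i. subst_raw \<theta> (\<theta>' \<sigma> i)"]
         scons_raw_def subst_raw_up_shift split: nat.splits,
       simp add: up_raw_def scons_raw_def)
  with Lam show ?case by simp
qed auto

lemma subst_raw_beta:
  "subst_raw \<theta> (subst_raw (scons_raw \<tau> u Var) t) =
   subst_raw (scons_raw \<tau> (subst_raw \<theta> u) Var) (subst_raw (up_raw \<tau> \<theta>) t)"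
proof -
  have cancel: "subst_raw (scons_raw \<tau> v Var) (ren (shift_ren [\<tau>]) s) = s" for v s :: "'a trm"
  proof -
    have "(\<lambda>\<sigma> i. scons_raw \<tau> v Var \<sigma> (shift_ren [\<tau>] \<sigma> i)) = Var"
      by (auto simp: scons_raw_def shift_ren_def fun_eq_iff)
    then show ?thesis by (simp add: subst_raw_ren subst_raw_Var)
  qed
  have "(\<lambda>\<sigma> i. subst_raw \<theta> (scons_raw \<tau> u Var \<sigma> i)) =
      (\<lambda>\<sigma> i. subst_raw (scons_raw \<tau> (subst_raw \<theta> u) Var) (up_raw \<tau> \<theta> \<sigma> i))"
    by (intro ext)
      (simp add: up_raw_def scons_raw_def [of _ "Var \<tau> 0"] cancel split: nat.splits,
       simp add: scons_raw_def split: nat.splits)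
  then show ?thesis by (simp add: subst_raw_subst_raw)
qed

lemma ren_as_subst_raw: "ren \<rho> t = subst_raw (\<lambda>\<sigma> i. Var \<sigma> (\<rho> \<sigma> i)) t"
  using ren_subst_raw [of \<rho> Var t] by (simp add: subst_raw_Var)

lemma conv_subst_raw_fixed:
  assumes "conv s t \<tau>" and "\<And>\<sigma> i. typeof (\<theta> \<sigma> i) = Some \<sigma>"
  shows "conv (subst_raw \<theta> s) (subst_raw \<theta> t) \<tau>"
  using assms
proof (induction arbitrary: \<theta> rule: conv.induct)
  case (conv_lam t t' \<sigma> \<tau>)
  have "conv (subst_raw (up_raw \<tau> \<theta>) t) (subst_raw (up_raw \<tau> \<theta>) t') \<sigma>"
    by (rule conv_lam.IH)
      (auto simp: up_raw_def scons_raw_def typeof_ren conv_lam.prems split: nat.splits)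
  then show ?case by (auto intro: conv.intros)
next
  case (conv_beta t \<sigma> u \<tau>)
  have "typeof (subst_raw (up_raw \<tau> \<theta>) t) = Some \<sigma>"
    by (subst typeof_subst_raw)
      (auto simp: up_raw_def scons_raw_def typeof_ren conv_beta split: nat.splits)
  moreover have "typeof (subst_raw \<theta> u) = Some \<tau>"
    by (simp add: typeof_subst_raw conv_beta)
  ultimately show ?case
    by (auto simp: subst_raw_beta intro: conv.intros)
next
  case (conv_eta t \<tau> \<sigma>)
  have "typeof (subst_raw \<theta> t) = Some (Fun \<tau> \<sigma>)"
    by (simp add: typeof_subst_raw conv_eta)
  moreover have "up_raw \<tau> \<theta> \<tau> 0 = Var \<tau> 0"
    by (simp add: up_raw_def scons_raw_def)
  ultimately show ?case
    by (auto simp: subst_raw_up_shift intro: conv.intros)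
next
  case (conv_trans s t \<tau> u)
  then show ?case by (blast intro: conv.conv_trans)
next
  case (conv_app s s' \<sigma> \<tau> t t')
  then show ?case by (auto intro: conv.conv_app)
qed (auto intro: conv.intros conv_refl)

lemma conv_ren: "conv s t \<tau> \<Longrightarrow> conv (ren \<rho> s) (ren \<rho> t) \<tau>"
  by (simp add: ren_as_subst_raw conv_subst_raw_fixed)

lemma conv_subst_raw_pointwise:
  assumes "typeof t = Some \<tau>" and "\<And>\<sigma> i. conv (\<theta> \<sigma> i) (\<theta>' \<sigma> i) \<sigma>"
  shows "conv (subst_raw \<theta> t) (subst_raw \<theta>' t) \<tau>"
  using assms
proof (induction t arbitrary: \<theta> \<theta>' \<tau>)
  case (App s t)
  from App.prems(1) obtain \<sigma> where st: "typeof s = Some (Fun \<sigma> \<tau>)" "typeof t = Some \<sigma>"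
    by (auto split: option.splits ty.splits if_splits)
  have "conv (subst_raw \<theta> s) (subst_raw \<theta>' s) (Fun \<sigma> \<tau>)"
    using st(1) App.prems(2) by (rule App.IH(1))
  moreover have "conv (subst_raw \<theta> t) (subst_raw \<theta>' t) \<sigma>"
    using st(2) App.prems(2) by (rule App.IH(2))
  ultimately show ?case by (auto intro: conv_app)
next
  case (Lam \<sigma> t)
  from Lam.prems obtain \<tau>' where \<tau>': "typeof t = Some \<tau>'" "\<tau> = Fun \<sigma> \<tau>'" by auto
  have "conv (subst_raw (up_raw \<sigma> \<theta>) t) (subst_raw (up_raw \<sigma> \<theta>') t) \<tau>'"
    by (rule Lam.IH [OF \<tau>'(1)])
      (auto simp: up_raw_def scons_raw_def conv_ren Lam.prems conv_var split: nat.splits)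
  with \<tau>' show ?case by (auto intro: conv.intros)
qed (auto intro: conv.intros)

lemma conv_subst_raw:
  assumes "conv s t \<tau>" and "\<And>\<sigma> i. conv (\<theta> \<sigma> i) (\<theta>' \<sigma> i) \<sigma>"
  shows "conv (subst_raw \<theta> s) (subst_raw \<theta>' t) \<tau>"
proof (rule conv_trans)
  show "conv (subst_raw \<theta> s) (subst_raw \<theta> t) \<tau>"
    using assms(1) conv_typeof [OF assms(2)] by (intro conv_subst_raw_fixed) simp_all
  show "conv (subst_raw \<theta> t) (subst_raw \<theta>' t) \<tau>"
    using conv_typeof [OF assms(1)] assms(2) by (intro conv_subst_raw_pointwise) simp_all
qed

quotient_type (overloaded) 'c tm = "'c::term_signature trm" / partial: "\<lambda>s t. \<exists>\<tau>. conv s t \<tau>"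
proof (rule part_equivpI)
  show "\<exists>t :: 'c trm. \<exists>\<tau>. conv t t \<tau>" by (blast intro: conv_var)
  show "symp (\<lambda>s t :: 'c trm. \<exists>\<tau>. conv s t \<tau>)" by (blast intro: sympI conv_sym)
  show "transp (\<lambda>s t :: 'c trm. \<exists>\<tau>. conv s t \<tau>)"
  proof (rule transpI, elim exE)
    fix s t u :: "'c trm" and \<tau> \<tau>'
    assume st: "conv s t \<tau>" and tu: "conv t u \<tau>'"
    from conv_typeof [OF st] conv_typeof [OF tu] have "\<tau>' = \<tau>" by simp
    with st tu show "\<exists>\<tau>. conv s u \<tau>" by (blast intro: conv_trans)
  qed
qed

quotient_type (overloaded) 'c sub = "ty \<Rightarrow> nat \<Rightarrow> 'c::term_signature trm" /
  partial: "\<lambda>\<theta> \<theta>'. \<forall>\<sigma> i. conv (\<theta> \<sigma> i) (\<theta>' \<sigma> i) \<sigma>"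
proof (rule part_equivpI)
  show "\<exists>\<theta> :: ty \<Rightarrow> nat \<Rightarrow> 'c trm. \<forall>\<sigma> i. conv (\<theta> \<sigma> i) (\<theta> \<sigma> i) \<sigma>"
    by (rule exI [of _ Var]) (simp add: conv_var)
next
  show "symp (\<lambda>\<theta> \<theta>' :: ty \<Rightarrow> nat \<Rightarrow> 'c trm. \<forall>\<sigma> i. conv (\<theta> \<sigma> i) (\<theta>' \<sigma> i) \<sigma>)"
    by (rule sympI) (simp add: conv_sym)
  show "transp (\<lambda>\<theta> \<theta>' :: ty \<Rightarrow> nat \<Rightarrow> 'c trm. \<forall>\<sigma> i. conv (\<theta> \<sigma> i) (\<theta>' \<sigma> i) \<sigma>)"
    by (rule transpI) (metis conv_trans)
qed

lift_definition tyof :: "'c::term_signature tm \<Rightarrow> ty" is "\<lambda>t. the (typeof t)"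
  using conv_typeof by fastforce

lift_definition var :: "ty \<Rightarrow> nat \<Rightarrow> 'c::term_signature tm" is Var
  by (blast intro: conv_var)

text \<open>Ill-typed applications are sent to an arbitrary term; \<open>app\<close> is only ever used under
  a typing condition.\<close>

lift_definition app :: "'c::term_signature tm \<Rightarrow> 'c tm \<Rightarrow> 'c tm"
  is "\<lambda>s t. if typeof (App s t) = None then Var (Base 0) 0 else App s t"
proof (elim exE)
  fix s s' t t' :: "'c trm" and \<sigma> \<tau>
  assume s: "conv s s' \<sigma>" and t: "conv t t' \<tau>"
  have eq: "typeof (App s t) = typeof (App s' t')"
    using conv_typeof [OF s] conv_typeof [OF t] by (simp split: ty.split)
  show "\<exists>\<rho>. conv (if typeof (App s t) = None then Var (Base 0) 0 else App s t)
         (if typeof (App s' t') = None then Var (Base 0) 0 else App s' t') \<rho>"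
  proof (cases "typeof (App s t) = None")
    case True
    with eq show ?thesis by (auto intro: conv_var)
  next
    case False
    then obtain \<rho> where "\<sigma> = Fun \<tau> \<rho>"
      using conv_typeof [OF s] conv_typeof [OF t] by (auto split: ty.splits if_splits)
    with s t False eq show ?thesis by (auto intro: conv_app simp del: typeof.simps)
  qed
qed

lift_definition lam :: "ty \<Rightarrow> 'c::term_signature tm \<Rightarrow> 'c tm" is Lam
  by (blast intro: conv_lam)

lift_definition subst :: "'c::term_signature sub \<Rightarrow> 'c tm \<Rightarrow> 'c tm" is subst_raw
  by (elim exE, rule exI, rule conv_subst_raw) simp_all

lift_definition shift :: "ty list \<Rightarrow> 'c::term_signature sub" is "\<lambda>\<tau>s \<sigma> i. Var \<sigma> (shift_ren \<tau>s \<sigma> i)"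
  by (simp add: conv_var)

definition ids :: "'c::term_signature sub" where
  "ids = shift []"

text \<open>\<open>scons t \<theta>\<close> sends index 0 of the type of \<open>t\<close> to \<open>t\<close> and the other variables, renumbered,
  where \<open>\<theta>\<close> does; \<open>scomp \<theta> \<theta>'\<close> applies \<open>\<theta>\<close> first.\<close>

lift_definition scons :: "'c::term_signature tm \<Rightarrow> 'c sub \<Rightarrow> 'c sub"
  is "\<lambda>t. scons_raw (the (typeof t)) t"
proof (elim exE)
  fix t t' :: "'c trm" and \<theta> \<theta>' :: "ty \<Rightarrow> nat \<Rightarrow> 'c trm" and \<tau> \<sigma> i
  assume "conv t t' \<tau>" and "\<And>\<sigma> i. conv (\<theta> \<sigma> i) (\<theta>' \<sigma> i) \<sigma>"
  then show "conv (scons_raw (the (typeof t)) t \<theta> \<sigma> i) (scons_raw (the (typeof t')) t' \<theta>' \<sigma> i) \<sigma>"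
    using conv_typeof [of t t' \<tau>] by (simp add: scons_raw_def split: nat.split)
qed

lift_definition scomp :: "'c::term_signature sub \<Rightarrow> 'c sub \<Rightarrow> 'c sub"
  is "\<lambda>\<theta> \<theta>' \<sigma> i. subst_raw \<theta>' (\<theta> \<sigma> i)"
  by (rule conv_subst_raw) simp_all

definition up :: "ty \<Rightarrow> 'c::term_signature sub \<Rightarrow> 'c sub" where
  "up \<tau> \<theta> = scons (var \<tau> 0) (scomp \<theta> (shift [\<tau>]))"

text \<open>A list of types \<open>[\<tau>\<^sub>1, \<dots>, \<tau>\<^sub>n]\<close> used as a binder stands for \<open>\<lambda>x\<^sub>1 \<dots> x\<^sub>n\<close> with \<open>x\<^sub>n\<close>
  innermost.  \<open>inst [t\<^sub>1, \<dots>, t\<^sub>n]\<close> instantiates \<open>x\<^sub>i\<close> with \<open>t\<^sub>i\<close>, and \<open>bvars\<close> is the list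
  \<open>[x\<^sub>1, \<dots>, x\<^sub>n]\<close> as seen in the body.\<close>

definition ups :: "ty list \<Rightarrow> 'c::term_signature sub \<Rightarrow> 'c sub" where
  "ups \<tau>s \<theta> = fold up \<tau>s \<theta>"

definition inst :: "'c::term_signature tm list \<Rightarrow> 'c sub" where
  "inst ts = fold scons ts ids"

fun bvars :: "ty list \<Rightarrow> 'c::term_signature tm list" where
  "bvars [] = []"
| "bvars (\<tau> # \<tau>s) = var \<tau> (count_list \<tau>s \<tau>) # bvars \<tau>s"


section \<open>Formulas\<close>

text \<open>Predicate constants are drawn from a fixed stock \<open>'p\<close>; a language declares some of
  them, with their argument types.  \<open>PVar \<tau>s k\<close> is a predicate variable with argument types
  \<open>\<tau>s\<close>, again with separate de Bruijn indices for each \<open>\<tau>s\<close>.  \<open>Mu \<tau>s P ts\<close> stands for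
  \<open>\<mu> (\<lambda>p \<lambda>x\<^sub>1 \<dots> x\<^sub>n. P) ts\<close>; in \<open>P\<close>, the variable \<open>p\<close> is \<open>PVar \<tau>s 0\<close>.\<close>

declare [[typedef_overloaded]]

datatype ('c::term_signature, 'p) fm =
    Top
  | Bot
  | Imp "('c, 'p) fm" "('c, 'p) fm"
  | Conj "('c, 'p) fm" "('c, 'p) fm"
  | Disj "('c, 'p) fm" "('c, 'p) fm"
  | All ty "('c, 'p) fm"
  | Ex ty "('c, 'p) fm"
  | Eq "'c tm" "'c tm"
  | Mu "ty list" "('c, 'p) fm" "'c tm list"
  | Nu "ty list" "('c, 'p) fm" "'c tm list"
  | PVar "ty list" nat "'c tm list"
  | Atom 'p "'c tm list"

type_synonym 'p lang = "'p \<Rightarrow> ty list option"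

primrec fsubst :: "'c::term_signature sub \<Rightarrow> ('c, 'p) fm \<Rightarrow> ('c, 'p) fm" where
  "fsubst \<theta> Top = Top"
| "fsubst \<theta> Bot = Bot"
| "fsubst \<theta> (Imp P Q) = Imp (fsubst \<theta> P) (fsubst \<theta> Q)"
| "fsubst \<theta> (Conj P Q) = Conj (fsubst \<theta> P) (fsubst \<theta> Q)"
| "fsubst \<theta> (Disj P Q) = Disj (fsubst \<theta> P) (fsubst \<theta> Q)"
| "fsubst \<theta> (All \<tau> P) = All \<tau> (fsubst (up \<tau> \<theta>) P)"
| "fsubst \<theta> (Ex \<tau> P) = Ex \<tau> (fsubst (up \<tau> \<theta>) P)"
| "fsubst \<theta> (Eq s t) = Eq (subst \<theta> s) (subst \<theta> t)"
| "fsubst \<theta> (Mu \<tau>s P ts) = Mu \<tau>s (fsubst (ups \<tau>s \<theta>) P) (map (subst \<theta>) ts)"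
| "fsubst \<theta> (Nu \<tau>s P ts) = Nu \<tau>s (fsubst (ups \<tau>s \<theta>) P) (map (subst \<theta>) ts)"
| "fsubst \<theta> (PVar \<tau>s k ts) = PVar \<tau>s k (map (subst \<theta>) ts)"
| "fsubst \<theta> (Atom a ts) = Atom a (map (subst \<theta>) ts)"

lemma size_fsubst [simp]: "size (fsubst \<theta> P) = size P"
  by (induction P arbitrary: \<theta>) auto

text \<open>Index of an outer predicate variable \<open>PVar \<sigma>s k\<close> below a binder for \<open>\<tau>s\<close>.\<close>

definition under :: "ty list \<Rightarrow> ty list \<Rightarrow> nat \<Rightarrow> nat" where
  "under \<tau>s \<sigma>s k = (if \<sigma>s = \<tau>s then Suc k else k)"

primrec pvar_occurs :: "ty list \<Rightarrow> nat \<Rightarrow> ('c::term_signature, 'p) fm \<Rightarrow> bool" where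
  "pvar_occurs \<sigma>s k Top = False"
| "pvar_occurs \<sigma>s k Bot = False"
| "pvar_occurs \<sigma>s k (Imp P Q) = (pvar_occurs \<sigma>s k P \<or> pvar_occurs \<sigma>s k Q)"
| "pvar_occurs \<sigma>s k (Conj P Q) = (pvar_occurs \<sigma>s k P \<or> pvar_occurs \<sigma>s k Q)"
| "pvar_occurs \<sigma>s k (Disj P Q) = (pvar_occurs \<sigma>s k P \<or> pvar_occurs \<sigma>s k Q)"
| "pvar_occurs \<sigma>s k (All \<tau> P) = pvar_occurs \<sigma>s k P"
| "pvar_occurs \<sigma>s k (Ex \<tau> P) = pvar_occurs \<sigma>s k P"
| "pvar_occurs \<sigma>s k (Eq s t) = False"
| "pvar_occurs \<sigma>s k (Mu \<tau>s P ts) = pvar_occurs \<sigma>s (under \<tau>s \<sigma>s k) P"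
| "pvar_occurs \<sigma>s k (Nu \<tau>s P ts) = pvar_occurs \<sigma>s (under \<tau>s \<sigma>s k) P"
| "pvar_occurs \<sigma>s k (PVar \<tau>s j ts) = (\<tau>s = \<sigma>s \<and> j = k)"
| "pvar_occurs \<sigma>s k (Atom a ts) = False"

text \<open>\<open>polar True \<sigma>s k P\<close>: the variable \<open>PVar \<sigma>s k\<close> occurs only positively in \<open>P\<close>;
  \<open>polar False\<close>: only negatively.\<close>

primrec polar :: "bool \<Rightarrow> ty list \<Rightarrow> nat \<Rightarrow> ('c::term_signature, 'p) fm \<Rightarrow> bool" where
  "polar b \<sigma>s k Top = True"
| "polar b \<sigma>s k Bot = True"
| "polar b \<sigma>s k (Imp P Q) = (polar (\<not> b) \<sigma>s k P \<and> polar b \<sigma>s k Q)"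
| "polar b \<sigma>s k (Conj P Q) = (polar b \<sigma>s k P \<and> polar b \<sigma>s k Q)"
| "polar b \<sigma>s k (Disj P Q) = (polar b \<sigma>s k P \<and> polar b \<sigma>s k Q)"
| "polar b \<sigma>s k (All \<tau> P) = polar b \<sigma>s k P"
| "polar b \<sigma>s k (Ex \<tau> P) = polar b \<sigma>s k P"
| "polar b \<sigma>s k (Eq s t) = True"
| "polar b \<sigma>s k (Mu \<tau>s P ts) = polar b \<sigma>s (under \<tau>s \<sigma>s k) P"
| "polar b \<sigma>s k (Nu \<tau>s P ts) = polar b \<sigma>s (under \<tau>s \<sigma>s k) P"
| "polar b \<sigma>s k (PVar \<tau>s j ts) = (b \<or> (\<tau>s, j) \<noteq> (\<sigma>s, k))"
| "polar b \<sigma>s k (Atom a ts) = True"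

primrec wff :: "'p lang \<Rightarrow> ('c::term_signature, 'p) fm \<Rightarrow> bool" where
  "wff L Top = True"
| "wff L Bot = True"
| "wff L (Imp P Q) = (wff L P \<and> wff L Q)"
| "wff L (Conj P Q) = (wff L P \<and> wff L Q)"
| "wff L (Disj P Q) = (wff L P \<and> wff L Q)"
| "wff L (All \<tau> P) = wff L P"
| "wff L (Ex \<tau> P) = wff L P"
| "wff L (Eq s t) = (tyof s = tyof t)"
| "wff L (Mu \<tau>s P ts) = (wff L P \<and> polar True \<tau>s 0 P \<and> map tyof ts = \<tau>s)"
| "wff L (Nu \<tau>s P ts) = (wff L P \<and> polar True \<tau>s 0 P \<and> map tyof ts = \<tau>s)"
| "wff L (PVar \<tau>s k ts) = (map tyof ts = \<tau>s)"
| "wff L (Atom a ts) = (L a = Some (map tyof ts))"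

definition no_free_pvars :: "('c::term_signature, 'p) fm \<Rightarrow> bool" where
  "no_free_pvars P \<longleftrightarrow> (\<forall>\<sigma>s k. \<not> pvar_occurs \<sigma>s k P)"

text \<open>\<open>occurs_in \<tau>s P' Q\<close>: \<open>P'\<close> occurs in \<open>Q\<close>, in the scope of bound term variables of types
  \<open>\<tau>s\<close> (outermost first).  The variables abstracted in the body of a fixed point are bound
  in the same way as quantified ones.\<close>

inductive occurs_in ::
  "ty list \<Rightarrow> ('c::term_signature, 'p) fm \<Rightarrow> ('c, 'p) fm \<Rightarrow> bool" where
  "occurs_in [] P P"
| "occurs_in \<tau>s P' P \<Longrightarrow> occurs_in \<tau>s P' (Imp P Q)"
| "occurs_in \<tau>s P' Q \<Longrightarrow> occurs_in \<tau>s P' (Imp P Q)"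
| "occurs_in \<tau>s P' P \<Longrightarrow> occurs_in \<tau>s P' (Conj P Q)"
| "occurs_in \<tau>s P' Q \<Longrightarrow> occurs_in \<tau>s P' (Conj P Q)"
| "occurs_in \<tau>s P' P \<Longrightarrow> occurs_in \<tau>s P' (Disj P Q)"
| "occurs_in \<tau>s P' Q \<Longrightarrow> occurs_in \<tau>s P' (Disj P Q)"
| "occurs_in \<tau>s P' P \<Longrightarrow> occurs_in (\<tau> # \<tau>s) P' (All \<tau> P)"
| "occurs_in \<tau>s P' P \<Longrightarrow> occurs_in (\<tau> # \<tau>s) P' (Ex \<tau> P)"
| "occurs_in \<tau>s P' P \<Longrightarrow> occurs_in (\<sigma>s @ \<tau>s) P' (Mu \<sigma>s P ts)"
| "occurs_in \<tau>s P' P \<Longrightarrow> occurs_in (\<sigma>s @ \<tau>s) P' (Nu \<sigma>s P ts)"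

definition may_occur_in :: "('c::term_signature, 'p) fm \<Rightarrow> ('c, 'p) fm \<Rightarrow> bool" where
  "may_occur_in P Q \<longleftrightarrow> (\<exists>P' ts. occurs_in (map tyof ts) P' Q \<and> P = fsubst (inst ts) P')"


section \<open>Rewrite systems and congruences\<close>

type_synonym 'c trules = "('c tm \<times> 'c tm) set"

type_synonym ('c, 'p) arules = "('p \<times> 'c tm list \<times> ('c, 'p) fm) set"

definition wf_trules :: "'c::term_signature trules \<Rightarrow> bool" where
  "wf_trules R \<longleftrightarrow> (\<forall>(l, r) \<in> R. tyof l = tyof r)"

text \<open>In \<open>wf_arules K L A\<close>, the left-hand sides are headed by constants of \<open>K\<close> and the
  right-hand sides are formulas of the language \<open>L\<close>.\<close>

definition wf_arules ::
  "'p lang \<Rightarrow> 'p lang \<Rightarrow> ('c::term_signature, 'p) arules \<Rightarrow> bool" where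
  "wf_arules K L A \<longleftrightarrow>
    (\<forall>(a, ts, B) \<in> A. K a = Some (map tyof ts) \<and> wff L B \<and> no_free_pvars B)"

inductive tcong :: "'c::term_signature trules \<Rightarrow> 'c tm \<Rightarrow> 'c tm \<Rightarrow> bool" for R where
  tcong_rule: "(l, r) \<in> R \<Longrightarrow> tcong R (subst \<theta> l) (subst \<theta> r)"
| tcong_refl: "tcong R t t"
| tcong_sym: "tcong R s t \<Longrightarrow> tcong R t s"
| tcong_trans: "tcong R s t \<Longrightarrow> tcong R t u \<Longrightarrow> tcong R s u"
| tcong_app: "tcong R s s' \<Longrightarrow> tcong R t t' \<Longrightarrow> tyof s = Fun (tyof t) \<tau> \<Longrightarrow>
    tcong R (app s t) (app s' t')"
| tcong_lam: "tcong R t t' \<Longrightarrow> tcong R (lam \<tau> t) (lam \<tau> t')"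

abbreviation tscong :: "'c::term_signature trules \<Rightarrow> 'c tm list \<Rightarrow> 'c tm list \<Rightarrow> bool" where
  "tscong R \<equiv> list_all2 (tcong R)"

definition scong :: "'c::term_signature trules \<Rightarrow> 'c sub \<Rightarrow> 'c sub \<Rightarrow> bool" where
  "scong R \<theta> \<theta>' \<longleftrightarrow> (\<forall>\<tau> i. tcong R (subst \<theta> (var \<tau> i)) (subst \<theta>' (var \<tau> i)))"

inductive fcong ::
  "'c::term_signature trules \<Rightarrow> ('c, 'p) arules \<Rightarrow> ('c, 'p) fm \<Rightarrow> ('c, 'p) fm \<Rightarrow> bool"
  for R A where
  fcong_rule: "(a, ts, B) \<in> A \<Longrightarrow> fcong R A (Atom a (map (subst \<theta>) ts)) (fsubst \<theta> B)"
| fcong_refl: "fcong R A P P"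
| fcong_sym: "fcong R A P Q \<Longrightarrow> fcong R A Q P"
| fcong_trans: "fcong R A P Q \<Longrightarrow> fcong R A Q S \<Longrightarrow> fcong R A P S"
| fcong_Imp: "fcong R A P P' \<Longrightarrow> fcong R A Q Q' \<Longrightarrow> fcong R A (Imp P Q) (Imp P' Q')"
| fcong_Conj: "fcong R A P P' \<Longrightarrow> fcong R A Q Q' \<Longrightarrow> fcong R A (Conj P Q) (Conj P' Q')"
| fcong_Disj: "fcong R A P P' \<Longrightarrow> fcong R A Q Q' \<Longrightarrow> fcong R A (Disj P Q) (Disj P' Q')"
| fcong_All: "fcong R A P P' \<Longrightarrow> fcong R A (All \<tau> P) (All \<tau> P')"
| fcong_Ex: "fcong R A P P' \<Longrightarrow> fcong R A (Ex \<tau> P) (Ex \<tau> P')"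
| fcong_Eq: "tcong R s s' \<Longrightarrow> tcong R t t' \<Longrightarrow> fcong R A (Eq s t) (Eq s' t')"
| fcong_Mu: "fcong R A P P' \<Longrightarrow> tscong R ts ts' \<Longrightarrow> fcong R A (Mu \<tau>s P ts) (Mu \<tau>s P' ts')"
| fcong_Nu: "fcong R A P P' \<Longrightarrow> tscong R ts ts' \<Longrightarrow> fcong R A (Nu \<tau>s P ts) (Nu \<tau>s P' ts')"
| fcong_PVar: "tscong R ts ts' \<Longrightarrow> fcong R A (PVar \<tau>s k ts) (PVar \<tau>s k ts')"
| fcong_Atom: "tscong R ts ts' \<Longrightarrow> fcong R A (Atom a ts) (Atom a ts')"


section \<open>Proof terms\<close>

text \<open>Proof variables are de Bruijn indices of their own.  Binding: \<open>PAbs\<close> and the last two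
  arguments of \<open>OrE\<close> bind a proof variable, \<open>TAbs \<tau>\<close> a term variable, and the last argument
  of \<open>ExE \<tau>\<close>, \<open>MuE \<tau>s\<close> and \<open>NuI \<tau>s\<close> term variables and then a proof variable.  The operator
  of \<open>MuI \<tau>s P ts \<pi>\<close> and \<open>NuE \<tau>s P ts \<pi>\<close> is \<open>\<lambda>p \<lambda>x\<^sub>1 \<dots> x\<^sub>n. P\<close>.

  \<open>EqE \<Gamma> \<theta> \<sigma> u v P \<pi> [(\<theta>\<^sub>1, \<pi>\<^sub>1), \<dots>]\<close> derives \<open>P\<theta>\<close> from a proof \<open>\<pi>\<close> of \<open>u\<theta> = v\<theta>\<close>, proofs \<open>\<sigma>\<close>
  of \<open>\<Gamma>\<theta>\<close>, and a proof \<open>\<pi>\<^sub>i\<close> of \<open>P\<theta>\<^sub>i\<close> from \<open>\<Gamma>\<theta>\<^sub>i\<close> for each member \<open>\<theta>\<^sub>i\<close> of a complete set of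
  unifiers of \<open>u\<close> and \<open>v\<close>.  The substitutions \<open>\<theta>\<close> and \<open>\<sigma>\<close> are suspended: \<open>\<Gamma>\<close>, \<open>u\<close>, \<open>v\<close>, \<open>P\<close>
  and the branches live in a scope of their own, which outer substitutions do not enter.\<close>

datatype ('c::term_signature, 'p) pf =
    PV nat
  | Unit
  | BotE "('c, 'p) pf"
  | PAbs "('c, 'p) pf"
  | PApp "('c, 'p) pf" "('c, 'p) pf"
  | Pair "('c, 'p) pf" "('c, 'p) pf"
  | Proj1 "('c, 'p) pf"
  | Proj2 "('c, 'p) pf"
  | In1 "('c, 'p) pf"
  | In2 "('c, 'p) pf"
  | OrE "('c, 'p) pf" "('c, 'p) pf" "('c, 'p) pf"
  | TAbs ty "('c, 'p) pf"
  | TApp "('c, 'p) pf" "'c tm"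
  | Wit "'c tm" "('c, 'p) pf"
  | ExE ty "('c, 'p) pf" "('c, 'p) pf"
  | Refl "'c tm"
  | EqE "('c, 'p) fm list" "'c sub" "('c, 'p) pf list" "'c tm" "'c tm" "('c, 'p) fm"
      "('c, 'p) pf" "('c sub \<times> ('c, 'p) pf) list"
  | MuI "ty list" "('c, 'p) fm" "'c tm list" "('c, 'p) pf"
  | MuE "ty list" "('c, 'p) pf" "('c, 'p) pf"
  | NuI "ty list" "('c, 'p) pf" "('c, 'p) pf"
  | NuE "ty list" "('c, 'p) fm" "'c tm list" "('c, 'p) pf"

fun pf_tsub :: "'c::term_signature sub \<Rightarrow> ('c, 'p) pf \<Rightarrow> ('c, 'p) pf" where
  "pf_tsub \<theta> (PV n) = PV n"
| "pf_tsub \<theta> Unit = Unit"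
| "pf_tsub \<theta> (BotE \<pi>) = BotE (pf_tsub \<theta> \<pi>)"
| "pf_tsub \<theta> (PAbs \<pi>) = PAbs (pf_tsub \<theta> \<pi>)"
| "pf_tsub \<theta> (PApp \<pi> \<pi>') = PApp (pf_tsub \<theta> \<pi>) (pf_tsub \<theta> \<pi>')"
| "pf_tsub \<theta> (Pair \<pi> \<pi>') = Pair (pf_tsub \<theta> \<pi>) (pf_tsub \<theta> \<pi>')"
| "pf_tsub \<theta> (Proj1 \<pi>) = Proj1 (pf_tsub \<theta> \<pi>)"
| "pf_tsub \<theta> (Proj2 \<pi>) = Proj2 (pf_tsub \<theta> \<pi>)"
| "pf_tsub \<theta> (In1 \<pi>) = In1 (pf_tsub \<theta> \<pi>)"
| "pf_tsub \<theta> (In2 \<pi>) = In2 (pf_tsub \<theta> \<pi>)"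
| "pf_tsub \<theta> (OrE \<pi> \<pi>1 \<pi>2) = OrE (pf_tsub \<theta> \<pi>) (pf_tsub \<theta> \<pi>1) (pf_tsub \<theta> \<pi>2)"
| "pf_tsub \<theta> (TAbs \<tau> \<pi>) = TAbs \<tau> (pf_tsub (up \<tau> \<theta>) \<pi>)"
| "pf_tsub \<theta> (TApp \<pi> t) = TApp (pf_tsub \<theta> \<pi>) (subst \<theta> t)"
| "pf_tsub \<theta> (Wit t \<pi>) = Wit (subst \<theta> t) (pf_tsub \<theta> \<pi>)"
| "pf_tsub \<theta> (ExE \<tau> \<pi> \<pi>') = ExE \<tau> (pf_tsub \<theta> \<pi>) (pf_tsub (up \<tau> \<theta>) \<pi>')"
| "pf_tsub \<theta> (Refl t) = Refl (subst \<theta> t)"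
| "pf_tsub \<theta> (EqE \<Gamma> \<eta> ps u v P \<pi> bs) =
    EqE \<Gamma> (scomp \<eta> \<theta>) (map (pf_tsub \<theta>) ps) u v P (pf_tsub \<theta> \<pi>) bs"
| "pf_tsub \<theta> (MuI \<tau>s P ts \<pi>) = MuI \<tau>s (fsubst (ups \<tau>s \<theta>) P) (map (subst \<theta>) ts) (pf_tsub \<theta> \<pi>)"
| "pf_tsub \<theta> (MuE \<tau>s \<pi> \<pi>') = MuE \<tau>s (pf_tsub \<theta> \<pi>) (pf_tsub (ups \<tau>s \<theta>) \<pi>')"
| "pf_tsub \<theta> (NuI \<tau>s \<pi> \<pi>') = NuI \<tau>s (pf_tsub \<theta> \<pi>) (pf_tsub (ups \<tau>s \<theta>) \<pi>')"
| "pf_tsub \<theta> (NuE \<tau>s P ts \<pi>) = NuE \<tau>s (fsubst (ups \<tau>s \<theta>) P) (map (subst \<theta>) ts) (pf_tsub \<theta> \<pi>)"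

definition up_pren :: "(nat \<Rightarrow> nat) \<Rightarrow> nat \<Rightarrow> nat" where
  "up_pren \<rho> = case_nat 0 (\<lambda>n. Suc (\<rho> n))"

fun pf_ren :: "(nat \<Rightarrow> nat) \<Rightarrow> ('c::term_signature, 'p) pf \<Rightarrow> ('c, 'p) pf" where
  "pf_ren \<rho> (PV n) = PV (\<rho> n)"
| "pf_ren \<rho> Unit = Unit"
| "pf_ren \<rho> (BotE \<pi>) = BotE (pf_ren \<rho> \<pi>)"
| "pf_ren \<rho> (PAbs \<pi>) = PAbs (pf_ren (up_pren \<rho>) \<pi>)"
| "pf_ren \<rho> (PApp \<pi> \<pi>') = PApp (pf_ren \<rho> \<pi>) (pf_ren \<rho> \<pi>')"
| "pf_ren \<rho> (Pair \<pi> \<pi>') = Pair (pf_ren \<rho> \<pi>) (pf_ren \<rho> \<pi>')"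
| "pf_ren \<rho> (Proj1 \<pi>) = Proj1 (pf_ren \<rho> \<pi>)"
| "pf_ren \<rho> (Proj2 \<pi>) = Proj2 (pf_ren \<rho> \<pi>)"
| "pf_ren \<rho> (In1 \<pi>) = In1 (pf_ren \<rho> \<pi>)"
| "pf_ren \<rho> (In2 \<pi>) = In2 (pf_ren \<rho> \<pi>)"
| "pf_ren \<rho> (OrE \<pi> \<pi>1 \<pi>2) = OrE (pf_ren \<rho> \<pi>) (pf_ren (up_pren \<rho>) \<pi>1) (pf_ren (up_pren \<rho>) \<pi>2)"
| "pf_ren \<rho> (TAbs \<tau> \<pi>) = TAbs \<tau> (pf_ren \<rho> \<pi>)"
| "pf_ren \<rho> (TApp \<pi> t) = TApp (pf_ren \<rho> \<pi>) t"
| "pf_ren \<rho> (Wit t \<pi>) = Wit t (pf_ren \<rho> \<pi>)"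
| "pf_ren \<rho> (ExE \<tau> \<pi> \<pi>') = ExE \<tau> (pf_ren \<rho> \<pi>) (pf_ren (up_pren \<rho>) \<pi>')"
| "pf_ren \<rho> (Refl t) = Refl t"
| "pf_ren \<rho> (EqE \<Gamma> \<eta> ps u v P \<pi> bs) = EqE \<Gamma> \<eta> (map (pf_ren \<rho>) ps) u v P (pf_ren \<rho> \<pi>) bs"
| "pf_ren \<rho> (MuI \<tau>s P ts \<pi>) = MuI \<tau>s P ts (pf_ren \<rho> \<pi>)"
| "pf_ren \<rho> (MuE \<tau>s \<pi> \<pi>') = MuE \<tau>s (pf_ren \<rho> \<pi>) (pf_ren (up_pren \<rho>) \<pi>')"
| "pf_ren \<rho> (NuI \<tau>s \<pi> \<pi>') = NuI \<tau>s (pf_ren \<rho> \<pi>) (pf_ren (up_pren \<rho>) \<pi>')"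
| "pf_ren \<rho> (NuE \<tau>s P ts \<pi>) = NuE \<tau>s P ts (pf_ren \<rho> \<pi>)"

definition up_psub ::
  "ty list \<Rightarrow> (nat \<Rightarrow> ('c::term_signature, 'p) pf) \<Rightarrow> nat \<Rightarrow> ('c, 'p) pf" where
  "up_psub \<tau>s s = case_nat (PV 0) (\<lambda>n. pf_ren Suc (pf_tsub (shift \<tau>s) (s n)))"

fun pf_sub ::
  "(nat \<Rightarrow> ('c::term_signature, 'p) pf) \<Rightarrow> ('c, 'p) pf \<Rightarrow> ('c, 'p) pf" where
  "pf_sub s (PV n) = s n"
| "pf_sub s Unit = Unit"
| "pf_sub s (BotE \<pi>) = BotE (pf_sub s \<pi>)"
| "pf_sub s (PAbs \<pi>) = PAbs (pf_sub (up_psub [] s) \<pi>)"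
| "pf_sub s (PApp \<pi> \<pi>') = PApp (pf_sub s \<pi>) (pf_sub s \<pi>')"
| "pf_sub s (Pair \<pi> \<pi>') = Pair (pf_sub s \<pi>) (pf_sub s \<pi>')"
| "pf_sub s (Proj1 \<pi>) = Proj1 (pf_sub s \<pi>)"
| "pf_sub s (Proj2 \<pi>) = Proj2 (pf_sub s \<pi>)"
| "pf_sub s (In1 \<pi>) = In1 (pf_sub s \<pi>)"
| "pf_sub s (In2 \<pi>) = In2 (pf_sub s \<pi>)"
| "pf_sub s (OrE \<pi> \<pi>1 \<pi>2) =
    OrE (pf_sub s \<pi>) (pf_sub (up_psub [] s) \<pi>1) (pf_sub (up_psub [] s) \<pi>2)"
| "pf_sub s (TAbs \<tau> \<pi>) = TAbs \<tau> (pf_sub (\<lambda>n. pf_tsub (shift [\<tau>]) (s n)) \<pi>)"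
| "pf_sub s (TApp \<pi> t) = TApp (pf_sub s \<pi>) t"
| "pf_sub s (Wit t \<pi>) = Wit t (pf_sub s \<pi>)"
| "pf_sub s (ExE \<tau> \<pi> \<pi>') = ExE \<tau> (pf_sub s \<pi>) (pf_sub (up_psub [\<tau>] s) \<pi>')"
| "pf_sub s (Refl t) = Refl t"
| "pf_sub s (EqE \<Gamma> \<eta> ps u v P \<pi> bs) = EqE \<Gamma> \<eta> (map (pf_sub s) ps) u v P (pf_sub s \<pi>) bs"
| "pf_sub s (MuI \<tau>s P ts \<pi>) = MuI \<tau>s P ts (pf_sub s \<pi>)"
| "pf_sub s (MuE \<tau>s \<pi> \<pi>') = MuE \<tau>s (pf_sub s \<pi>) (pf_sub (up_psub \<tau>s s) \<pi>')"
| "pf_sub s (NuI \<tau>s \<pi> \<pi>') = NuI \<tau>s (pf_sub s \<pi>) (pf_sub (up_psub \<tau>s s) \<pi>')"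
| "pf_sub s (NuE \<tau>s P ts \<pi>) = NuE \<tau>s P ts (pf_sub s \<pi>)"

text \<open>\<open>pf_inst ts \<pi> \<pi>'\<close> is \<open>\<pi>'[ts/x\<^sub>1 \<dots> x\<^sub>n][\<pi>/\<alpha>]\<close>, for \<open>\<pi>'\<close> in the scope of
  \<open>x\<^sub>1 \<dots> x\<^sub>n\<close> and then \<open>\<alpha>\<close>; \<open>pf_insts\<close> instantiates the proof variables of a whole context.\<close>

definition pf_inst ::
  "'c::term_signature tm list \<Rightarrow> ('c, 'p) pf \<Rightarrow> ('c, 'p) pf \<Rightarrow> ('c, 'p) pf" where
  "pf_inst ts \<pi> \<pi>' = pf_sub (case_nat \<pi> PV) (pf_tsub (inst ts) \<pi>')"

definition pf_insts ::
  "('c::term_signature, 'p) pf list \<Rightarrow> ('c, 'p) pf \<Rightarrow> ('c, 'p) pf" where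
  "pf_insts ps = pf_sub (\<lambda>n. if n < length ps then ps ! n else PV (n - length ps))"

text \<open>Weakening by term variables \<open>\<tau>s\<close> and a proof variable, of a proof term that is itself in
  the scope of bound term variables \<open>\<sigma>s\<close> and then a bound proof variable.\<close>

definition pf_weaken ::
  "ty list \<Rightarrow> ty list \<Rightarrow> ('c::term_signature, 'p) pf \<Rightarrow> ('c, 'p) pf" where
  "pf_weaken \<tau>s \<sigma>s \<pi> = pf_ren (up_pren Suc) (pf_tsub (ups \<sigma>s (shift \<tau>s)) \<pi>)"


subsection \<open>Functoriality of positive operators\<close>

primrec pren :: "(ty list \<Rightarrow> nat \<Rightarrow> nat) \<Rightarrow> ('c::term_signature, 'p) fm \<Rightarrow> ('c, 'p) fm" where
  "pren \<rho> Top = Top"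
| "pren \<rho> Bot = Bot"
| "pren \<rho> (Imp P Q) = Imp (pren \<rho> P) (pren \<rho> Q)"
| "pren \<rho> (Conj P Q) = Conj (pren \<rho> P) (pren \<rho> Q)"
| "pren \<rho> (Disj P Q) = Disj (pren \<rho> P) (pren \<rho> Q)"
| "pren \<rho> (All \<tau> P) = All \<tau> (pren \<rho> P)"
| "pren \<rho> (Ex \<tau> P) = Ex \<tau> (pren \<rho> P)"
| "pren \<rho> (Eq s t) = Eq s t"
| "pren \<rho> (Mu \<tau>s P ts) = Mu \<tau>s (pren (\<rho>(\<tau>s := case_nat 0 (\<lambda>k. Suc (\<rho> \<tau>s k)))) P) ts"
| "pren \<rho> (Nu \<tau>s P ts) = Nu \<tau>s (pren (\<rho>(\<tau>s := case_nat 0 (\<lambda>k. Suc (\<rho> \<tau>s k)))) P) ts"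
| "pren \<rho> (PVar \<tau>s k ts) = PVar \<tau>s (\<rho> \<tau>s k) ts"
| "pren \<rho> (Atom a ts) = Atom a ts"

text \<open>A predicate substitution sends \<open>PVar \<sigma>s k\<close> to the body of a predicate abstraction over
  variables of types \<open>\<sigma>s\<close>.\<close>

type_synonym ('c, 'p) psub = "ty list \<Rightarrow> nat \<Rightarrow> ('c, 'p) fm"

definition pids :: "('c::term_signature, 'p) psub" where
  "pids \<sigma>s k = PVar \<sigma>s k (bvars \<sigma>s)"

definition pscons ::
  "ty list \<Rightarrow> ('c::term_signature, 'p) fm \<Rightarrow> ('c, 'p) psub \<Rightarrow> ('c, 'p) psub" where
  "pscons \<tau>s P \<psi> = \<psi>(\<tau>s := case_nat P (\<psi> \<tau>s))"

definition pshift_tm :: "ty list \<Rightarrow> ('c::term_signature, 'p) psub \<Rightarrow> ('c, 'p) psub" where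
  "pshift_tm \<tau>s \<psi> \<sigma>s k = fsubst (ups \<sigma>s (shift \<tau>s)) (\<psi> \<sigma>s k)"

definition pup :: "ty list \<Rightarrow> ('c::term_signature, 'p) psub \<Rightarrow> ('c, 'p) psub" where
  "pup \<tau>s \<psi> = pscons \<tau>s (pids \<tau>s 0) (\<lambda>\<sigma>s k. pren (under \<tau>s) (pshift_tm \<tau>s \<psi> \<sigma>s k))"

primrec psubst :: "('c::term_signature, 'p) psub \<Rightarrow> ('c, 'p) fm \<Rightarrow> ('c, 'p) fm" where
  "psubst \<psi> Top = Top"
| "psubst \<psi> Bot = Bot"
| "psubst \<psi> (Imp P Q) = Imp (psubst \<psi> P) (psubst \<psi> Q)"
| "psubst \<psi> (Conj P Q) = Conj (psubst \<psi> P) (psubst \<psi> Q)"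
| "psubst \<psi> (Disj P Q) = Disj (psubst \<psi> P) (psubst \<psi> Q)"
| "psubst \<psi> (All \<tau> P) = All \<tau> (psubst (pshift_tm [\<tau>] \<psi>) P)"
| "psubst \<psi> (Ex \<tau> P) = Ex \<tau> (psubst (pshift_tm [\<tau>] \<psi>) P)"
| "psubst \<psi> (Eq s t) = Eq s t"
| "psubst \<psi> (Mu \<tau>s P ts) = Mu \<tau>s (psubst (pup \<tau>s \<psi>) P) ts"
| "psubst \<psi> (Nu \<tau>s P ts) = Nu \<tau>s (psubst (pup \<tau>s \<psi>) P) ts"
| "psubst \<psi> (PVar \<tau>s k ts) = fsubst (inst ts) (\<psi> \<tau>s k)"
| "psubst \<psi> (Atom a ts) = Atom a ts"

text \<open>Let \<open>p = PVar \<tau>s k\<close> occur only positively in \<open>P\<close>, and let \<open>\<rho>\<close>, in the scope of term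
  variables of types \<open>\<tau>s\<close> and then a proof variable, turn proofs of \<open>\<psi> p\<close> into proofs of
  \<open>\<psi>' p\<close>, where \<open>\<psi>\<close> and \<open>\<psi>'\<close> agree elsewhere.  Then \<open>fmap \<tau>s k \<rho> \<psi> \<psi>' P \<pi>\<close> turns a proof
  \<open>\<pi>\<close> of \<open>P\<psi>\<close> into one of \<open>P\<psi>'\<close>.  In the premise of an implication \<open>p\<close> occurs only negatively
  and the roles of \<open>\<psi>\<close> and \<open>\<psi>'\<close> are exchanged.  The predicate substitutions only serve to fill
  in the operators recorded in \<open>MuI\<close> and \<open>NuE\<close>; \<open>p\<close>-free formulas are mapped by the identity.\<close>

primrec fmap ::
  "ty list \<Rightarrow> nat \<Rightarrow> ('c::term_signature, 'p) pf \<Rightarrow> ('c, 'p) psub \<Rightarrow> ('c, 'p) psub \<Rightarrow>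
   ('c, 'p) fm \<Rightarrow> ('c, 'p) pf \<Rightarrow> ('c, 'p) pf" where
  "fmap \<tau>s k \<rho> \<psi> \<psi>' Top \<pi> = \<pi>"
| "fmap \<tau>s k \<rho> \<psi> \<psi>' Bot \<pi> = \<pi>"
| "fmap \<tau>s k \<rho> \<psi> \<psi>' (Imp P Q) \<pi> =
    (if \<not> pvar_occurs \<tau>s k (Imp P Q) then \<pi>
     else PAbs (fmap \<tau>s k (pf_weaken [] \<tau>s \<rho>) \<psi> \<psi>' Q
            (PApp (pf_ren Suc \<pi>) (fmap \<tau>s k (pf_weaken [] \<tau>s \<rho>) \<psi>' \<psi> P (PV 0)))))"
| "fmap \<tau>s k \<rho> \<psi> \<psi>' (Conj P Q) \<pi> =
    (if \<not> pvar_occurs \<tau>s k (Conj P Q) then \<pi>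
     else Pair (fmap \<tau>s k \<rho> \<psi> \<psi>' P (Proj1 \<pi>)) (fmap \<tau>s k \<rho> \<psi> \<psi>' Q (Proj2 \<pi>)))"
| "fmap \<tau>s k \<rho> \<psi> \<psi>' (Disj P Q) \<pi> =
    (if \<not> pvar_occurs \<tau>s k (Disj P Q) then \<pi>
     else OrE \<pi> (In1 (fmap \<tau>s k (pf_weaken [] \<tau>s \<rho>) \<psi> \<psi>' P (PV 0)))
                (In2 (fmap \<tau>s k (pf_weaken [] \<tau>s \<rho>) \<psi> \<psi>' Q (PV 0))))"
| "fmap \<tau>s k \<rho> \<psi> \<psi>' (All \<tau> P) \<pi> =
    (if \<not> pvar_occurs \<tau>s k (All \<tau> P) then \<pi>
     else TAbs \<tau> (fmap \<tau>s k (pf_tsub (ups \<tau>s (shift [\<tau>])) \<rho>)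
            (pshift_tm [\<tau>] \<psi>) (pshift_tm [\<tau>] \<psi>') P
            (TApp (pf_tsub (shift [\<tau>]) \<pi>) (var \<tau> 0))))"
| "fmap \<tau>s k \<rho> \<psi> \<psi>' (Ex \<tau> P) \<pi> =
    (if \<not> pvar_occurs \<tau>s k (Ex \<tau> P) then \<pi>
     else ExE \<tau> \<pi> (Wit (var \<tau> 0) (fmap \<tau>s k (pf_weaken [\<tau>] \<tau>s \<rho>)
            (pshift_tm [\<tau>] \<psi>) (pshift_tm [\<tau>] \<psi>') P (PV 0))))"
| "fmap \<tau>s k \<rho> \<psi> \<psi>' (Eq s t) \<pi> = \<pi>"
| "fmap \<tau>s k \<rho> \<psi> \<psi>' (Mu \<sigma>s P ts) \<pi> =
    (if \<not> pvar_occurs \<tau>s k (Mu \<sigma>s P ts) then \<pi>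
     else
       let \<chi> = pshift_tm \<sigma>s \<psi>; \<chi>' = pshift_tm \<sigma>s \<psi>';
           Q = fsubst (ups \<sigma>s (shift \<sigma>s)) (psubst (pup \<sigma>s \<psi>') P);
           M = Mu \<sigma>s (fsubst (ups \<sigma>s (shift \<sigma>s)) Q) (bvars \<sigma>s)
       in MuE \<sigma>s \<pi> (MuI \<sigma>s Q (bvars \<sigma>s)
            (fmap \<tau>s (under \<sigma>s \<tau>s k) (pf_weaken \<sigma>s \<tau>s \<rho>)
               (pscons \<sigma>s M \<chi>) (pscons \<sigma>s M \<chi>') P (PV 0))))"
| "fmap \<tau>s k \<rho> \<psi> \<psi>' (Nu \<sigma>s P ts) \<pi> =
    (if \<not> pvar_occurs \<tau>s k (Nu \<sigma>s P ts) then \<pi>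
     else
       let \<chi> = pshift_tm \<sigma>s \<psi>; \<chi>' = pshift_tm \<sigma>s \<psi>';
           Q = fsubst (ups \<sigma>s (shift \<sigma>s)) (psubst (pup \<sigma>s \<psi>) P);
           N = Nu \<sigma>s (fsubst (ups \<sigma>s (shift \<sigma>s)) Q) (bvars \<sigma>s)
       in NuI \<sigma>s \<pi>
            (fmap \<tau>s (under \<sigma>s \<tau>s k) (pf_weaken \<sigma>s \<tau>s \<rho>)
               (pscons \<sigma>s N \<chi>) (pscons \<sigma>s N \<chi>') P (NuE \<sigma>s Q (bvars \<sigma>s) (PV 0))))"
| "fmap \<tau>s k \<rho> \<psi> \<psi>' (PVar \<sigma>s j ts) \<pi> =
    (if (\<sigma>s, j) = (\<tau>s, k) then pf_inst ts \<pi> \<rho> else \<pi>)"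
| "fmap \<tau>s k \<rho> \<psi> \<psi>' (Atom a ts) \<pi> = \<pi>"


subsection \<open>Reduction\<close>

text \<open>Terms inside proofs are compared modulo the congruence, so the selection of a branch in
  the equality rule depends on it.  The (co)invariant \<open>S\<close> to or from which functoriality maps
  is not recorded in \<open>MuE\<close> and \<open>NuI\<close>; it is a parameter of the two fixed-point rules and
  occurs in the reduct only inside recorded operators.\<close>

abbreviation fp_abs :: "(ty list \<Rightarrow> ('c::term_signature, 'p) fm \<Rightarrow> 'c tm list \<Rightarrow> ('c, 'p) fm) \<Rightarrow>
    ty list \<Rightarrow> ('c, 'p) fm \<Rightarrow> ('c, 'p) fm" where
  "fp_abs F \<tau>s P \<equiv> F \<tau>s (fsubst (ups \<tau>s (shift \<tau>s)) P) (bvars \<tau>s)"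

inductive step ::
  "'c::term_signature trules \<Rightarrow> ('c, 'p) pf \<Rightarrow> ('c, 'p) pf \<Rightarrow> bool" for R where
  "step R (PApp (PAbs \<pi>) \<pi>') (pf_inst [] \<pi>' \<pi>)"
| "step R (Proj1 (Pair \<pi>1 \<pi>2)) \<pi>1"
| "step R (Proj2 (Pair \<pi>1 \<pi>2)) \<pi>2"
| "step R (OrE (In1 \<pi>) \<pi>1 \<pi>2) (pf_inst [] \<pi> \<pi>1)"
| "step R (OrE (In2 \<pi>) \<pi>1 \<pi>2) (pf_inst [] \<pi> \<pi>2)"
| "tyof t = \<tau> \<Longrightarrow> step R (TApp (TAbs \<tau> \<pi>) t) (pf_tsub (inst [t]) \<pi>)"
| "tyof t = \<tau> \<Longrightarrow> step R (ExE \<tau> (Wit t \<pi>) \<pi>') (pf_inst [t] \<pi> \<pi>')"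
| "(\<eta>, \<pi>) \<in> set bs \<Longrightarrow> scong R \<theta> (scomp \<eta> \<theta>') \<Longrightarrow>
    step R (EqE \<Gamma> \<theta> ps u v P (Refl t) bs) (pf_insts ps (pf_tsub \<theta>' \<pi>))"
| "map tyof ts = \<tau>s \<Longrightarrow>
    step R (MuE \<tau>s (MuI \<tau>s P ts \<pi>) \<pi>')
      (pf_inst ts
        (fmap \<tau>s 0 (MuE \<tau>s (PV 0) (pf_weaken \<tau>s \<tau>s \<pi>'))
           (pscons \<tau>s (fp_abs Mu \<tau>s P) pids) (pscons \<tau>s S pids) (fsubst (inst ts) P) \<pi>)
        \<pi>')"
| "map tyof ts = \<tau>s \<Longrightarrow>
    step R (NuE \<tau>s P ts (NuI \<tau>s \<pi> \<pi>'))
      (fmap \<tau>s 0 (NuI \<tau>s (PV 0) (pf_weaken \<tau>s \<tau>s \<pi>'))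
         (pscons \<tau>s S pids) (pscons \<tau>s (fp_abs Nu \<tau>s P) pids) (fsubst (inst ts) P)
         (pf_inst ts \<pi> \<pi>'))"
| "step R \<pi> \<pi>' \<Longrightarrow> step R (BotE \<pi>) (BotE \<pi>')"
| "step R \<pi> \<pi>' \<Longrightarrow> step R (PAbs \<pi>) (PAbs \<pi>')"
| "step R \<pi> \<pi>' \<Longrightarrow> step R (PApp \<pi> \<pi>1) (PApp \<pi>' \<pi>1)"
| "step R \<pi> \<pi>' \<Longrightarrow> step R (PApp \<pi>1 \<pi>) (PApp \<pi>1 \<pi>')"
| "step R \<pi> \<pi>' \<Longrightarrow> step R (Pair \<pi> \<pi>1) (Pair \<pi>' \<pi>1)"
| "step R \<pi> \<pi>' \<Longrightarrow> step R (Pair \<pi>1 \<pi>) (Pair \<pi>1 \<pi>')"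
| "step R \<pi> \<pi>' \<Longrightarrow> step R (Proj1 \<pi>) (Proj1 \<pi>')"
| "step R \<pi> \<pi>' \<Longrightarrow> step R (Proj2 \<pi>) (Proj2 \<pi>')"
| "step R \<pi> \<pi>' \<Longrightarrow> step R (In1 \<pi>) (In1 \<pi>')"
| "step R \<pi> \<pi>' \<Longrightarrow> step R (In2 \<pi>) (In2 \<pi>')"
| "step R \<pi> \<pi>' \<Longrightarrow> step R (OrE \<pi> \<pi>1 \<pi>2) (OrE \<pi>' \<pi>1 \<pi>2)"
| "step R \<pi> \<pi>' \<Longrightarrow> step R (OrE \<pi>1 \<pi> \<pi>2) (OrE \<pi>1 \<pi>' \<pi>2)"
| "step R \<pi> \<pi>' \<Longrightarrow> step R (OrE \<pi>1 \<pi>2 \<pi>) (OrE \<pi>1 \<pi>2 \<pi>')"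
| "step R \<pi> \<pi>' \<Longrightarrow> step R (TAbs \<tau> \<pi>) (TAbs \<tau> \<pi>')"
| "step R \<pi> \<pi>' \<Longrightarrow> step R (TApp \<pi> t) (TApp \<pi>' t)"
| "step R \<pi> \<pi>' \<Longrightarrow> step R (Wit t \<pi>) (Wit t \<pi>')"
| "step R \<pi> \<pi>' \<Longrightarrow> step R (ExE \<tau> \<pi> \<pi>1) (ExE \<tau> \<pi>' \<pi>1)"
| "step R \<pi> \<pi>' \<Longrightarrow> step R (ExE \<tau> \<pi>1 \<pi>) (ExE \<tau> \<pi>1 \<pi>')"
| "step R \<pi> \<pi>' \<Longrightarrow>
    step R (EqE \<Gamma> \<theta> (ps @ \<pi> # ps') u v P \<pi>1 bs) (EqE \<Gamma> \<theta> (ps @ \<pi>' # ps') u v P \<pi>1 bs)"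
| "step R \<pi> \<pi>' \<Longrightarrow> step R (EqE \<Gamma> \<theta> ps u v P \<pi> bs) (EqE \<Gamma> \<theta> ps u v P \<pi>' bs)"
| "step R \<pi> \<pi>' \<Longrightarrow>
    step R (EqE \<Gamma> \<theta> ps u v P \<pi>1 (bs @ (\<eta>, \<pi>) # bs')) (EqE \<Gamma> \<theta> ps u v P \<pi>1 (bs @ (\<eta>, \<pi>') # bs'))"
| "step R \<pi> \<pi>' \<Longrightarrow> step R (MuI \<tau>s P ts \<pi>) (MuI \<tau>s P ts \<pi>')"
| "step R \<pi> \<pi>' \<Longrightarrow> step R (MuE \<tau>s \<pi> \<pi>1) (MuE \<tau>s \<pi>' \<pi>1)"
| "step R \<pi> \<pi>' \<Longrightarrow> step R (MuE \<tau>s \<pi>1 \<pi>) (MuE \<tau>s \<pi>1 \<pi>')"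
| "step R \<pi> \<pi>' \<Longrightarrow> step R (NuI \<tau>s \<pi> \<pi>1) (NuI \<tau>s \<pi>' \<pi>1)"
| "step R \<pi> \<pi>' \<Longrightarrow> step R (NuI \<tau>s \<pi>1 \<pi>) (NuI \<tau>s \<pi>1 \<pi>')"
| "step R \<pi> \<pi>' \<Longrightarrow> step R (NuE \<tau>s P ts \<pi>) (NuE \<tau>s P ts \<pi>')"

abbreviation steps ::
  "'c::term_signature trules \<Rightarrow> ('c, 'p) pf \<Rightarrow> ('c, 'p) pf \<Rightarrow> bool" where
  "steps R \<equiv> (step R)\<^sup>*\<^sup>*"

definition SN :: "'c::term_signature trules \<Rightarrow> ('c, 'p) pf set" where
  "SN R = {\<pi>. termip (step R) \<pi>}"

fun neutral :: "('c::term_signature, 'p) pf \<Rightarrow> bool" where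
  "neutral (PV n) = True"
| "neutral (BotE \<pi>) = True"
| "neutral (PApp \<pi> \<pi>') = True"
| "neutral (Proj1 \<pi>) = True"
| "neutral (Proj2 \<pi>) = True"
| "neutral (OrE \<pi> \<pi>1 \<pi>2) = True"
| "neutral (TApp \<pi> t) = True"
| "neutral (ExE \<tau> \<pi> \<pi>') = True"
| "neutral (EqE \<Gamma> \<theta> ps u v P \<pi> bs) = True"
| "neutral (MuE \<tau>s \<pi> \<pi>') = True"
| "neutral (NuE \<tau>s P ts \<pi>) = True"
| "neutral _ = False"


section \<open>Candidates, interpretations and pre-models\<close>

definition candidate :: "'c::term_signature trules \<Rightarrow> ('c, 'p) pf set \<Rightarrow> bool" where
  "candidate R C \<longleftrightarrow> C \<subseteq> SN R \<and>
    (\<forall>\<pi> \<pi>'. \<pi> \<in> C \<longrightarrow> step R \<pi> \<pi>' \<longrightarrow> \<pi>' \<in> C) \<and>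
    (\<forall>\<pi>. neutral \<pi> \<longrightarrow> (\<forall>\<pi>'. step R \<pi> \<pi>' \<longrightarrow> \<pi>' \<in> C) \<longrightarrow> \<pi> \<in> C)"

type_synonym ('c, 'p) pred = "'c tm list \<Rightarrow> ('c, 'p) pf set"

text \<open>Predicate candidates are functions of term tuples modulo the congruence: without the second
  condition, no pre-model could give \<open>p t\<close> and \<open>p t'\<close> the same interpretation for congruent
  \<open>t\<close> and \<open>t'\<close>.\<close>

definition pred_candidate :: "'c::term_signature trules \<Rightarrow> ('c, 'p) pred \<Rightarrow> bool" where
  "pred_candidate R X \<longleftrightarrow>
    (\<forall>ts. candidate R (X ts)) \<and> (\<forall>ts ts'. tscong R ts ts' \<longrightarrow> X ts = X ts')"

text \<open>Least and greatest fixed points in the complete lattice of predicate candidates, ordered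
  pointwise by inclusion: infima are intersections, suprema are least upper bounds among
  predicate candidates.\<close>

definition lfp_cand ::
  "'c::term_signature trules \<Rightarrow> (('c, 'p) pred \<Rightarrow> ('c, 'p) pred) \<Rightarrow> ('c, 'p) pred" where
  "lfp_cand R \<Phi> ts = \<Inter> {X ts | X. pred_candidate R X \<and> \<Phi> X \<le> X}"

definition gfp_cand ::
  "'c::term_signature trules \<Rightarrow> (('c, 'p) pred \<Rightarrow> ('c, 'p) pred) \<Rightarrow> ('c, 'p) pred" where
  "gfp_cand R \<Phi> ts =
    \<Inter> {Z ts | Z. pred_candidate R Z \<and> (\<forall>X. pred_candidate R X \<longrightarrow> X \<le> \<Phi> X \<longrightarrow> X \<le> Z)}"

type_synonym ('c, 'p) penv = "ty list \<Rightarrow> nat \<Rightarrow> ('c, 'p) pred"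

definition penv_cons ::
  "ty list \<Rightarrow> ('c::term_signature, 'p) pred \<Rightarrow> ('c, 'p) penv \<Rightarrow> ('c, 'p) penv" where
  "penv_cons \<tau>s X E = E(\<tau>s := case_nat X (E \<tau>s))"

text \<open>The clauses for fixed points do not mention the operators and terms recorded in \<open>MuI\<close> and
  \<open>NuE\<close>, which need only be congruent to those of the formula.  In the clause for \<open>\<nu>\<close>, the term
  \<open>NuE \<tau>s P ts (NuI \<tau>s \<pi>1 \<pi>2)\<close> reduces to the image of \<open>pf_inst ts \<pi>1 \<pi>2\<close> under the functorial
  action of the operator on the map \<open>\<pi>' \<mapsto> NuI \<tau>s \<pi>' \<pi>2\<close>.  That this image belongs to the body
  interpreted at \<open>X\<close> is expressed by \<open>pf_inst ts \<pi>1 \<pi>2\<close> belonging to the body interpreted at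
  some predicate candidate \<open>Y\<close> which that map sends into \<open>X\<close>; this is required of all
  tuples congruent to \<open>ts\<close>, since the tuple recorded in \<open>NuE\<close> may be any of them.\<close>

function interp ::
  "'c::term_signature trules \<Rightarrow> ('p \<Rightarrow> ('c, 'p) pred) \<Rightarrow> ('c, 'p) penv \<Rightarrow> ('c, 'p) fm \<Rightarrow>
   ('c, 'p) pf set" where
  "interp R M E Top = SN R"
| "interp R M E Bot = SN R"
| "interp R M E (Eq s t) = SN R"
| "interp R M E (Imp P Q) = {\<pi> \<in> SN R. \<forall>\<pi>1. steps R \<pi> (PAbs \<pi>1) \<longrightarrow>
     (\<forall>\<pi>2 \<in> interp R M E P. pf_inst [] \<pi>2 \<pi>1 \<in> interp R M E Q)}"
| "interp R M E (Conj P Q) = {\<pi> \<in> SN R. \<forall>\<pi>1 \<pi>2. steps R \<pi> (Pair \<pi>1 \<pi>2) \<longrightarrow>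
     \<pi>1 \<in> interp R M E P \<and> \<pi>2 \<in> interp R M E Q}"
| "interp R M E (Disj P Q) = {\<pi> \<in> SN R.
     (\<forall>\<pi>1. steps R \<pi> (In1 \<pi>1) \<longrightarrow> \<pi>1 \<in> interp R M E P) \<and>
     (\<forall>\<pi>2. steps R \<pi> (In2 \<pi>2) \<longrightarrow> \<pi>2 \<in> interp R M E Q)}"
| "interp R M E (All \<tau> P) = {\<pi> \<in> SN R. \<forall>\<pi>1. steps R \<pi> (TAbs \<tau> \<pi>1) \<longrightarrow>
     (\<forall>t. tyof t = \<tau> \<longrightarrow> pf_tsub (inst [t]) \<pi>1 \<in> interp R M E (fsubst (inst [t]) P))}"
| "interp R M E (Ex \<tau> P) = {\<pi> \<in> SN R. \<forall>t \<pi>1. steps R \<pi> (Wit t \<pi>1) \<longrightarrow> tyof t = \<tau> \<longrightarrow>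
     \<pi>1 \<in> interp R M E (fsubst (inst [t]) P)}"
| "interp R M E (Mu \<tau>s P ts) =
    lfp_cand R (\<lambda>X us. {\<pi> \<in> SN R. \<forall>Q vs \<pi>1. steps R \<pi> (MuI \<tau>s Q vs \<pi>1) \<longrightarrow>
      \<pi>1 \<in> interp R M (penv_cons \<tau>s X E) (fsubst (inst us) P)}) ts"
| "interp R M E (Nu \<tau>s P ts) =
    gfp_cand R (\<lambda>X us. {\<pi> \<in> SN R. \<forall>\<pi>1 \<pi>2. steps R \<pi> (NuI \<tau>s \<pi>1 \<pi>2) \<longrightarrow>
      (\<forall>vs. tscong R us vs \<longrightarrow>
        (\<exists>Y. pred_candidate R Y \<and>
           (\<forall>ws. map tyof ws = \<tau>s \<longrightarrow> (\<forall>\<pi>' \<in> Y ws. NuI \<tau>s \<pi>' \<pi>2 \<in> X ws)) \<and>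
           pf_inst vs \<pi>1 \<pi>2 \<in> interp R M (penv_cons \<tau>s Y E) (fsubst (inst vs) P)))}) ts"
| "interp R M E (PVar \<tau>s k ts) = E \<tau>s k ts"
| "interp R M E (Atom a ts) = M a ts"
  by pat_completeness auto
termination
  by (relation "measure (\<lambda>(R, M, E, P). size P)") auto

definition premodel ::
  "'c::term_signature trules \<Rightarrow> 'p lang \<Rightarrow> ('p \<Rightarrow> ('c, 'p) pred) \<Rightarrow> bool" where
  "premodel R L M \<longleftrightarrow> (\<forall>a ts. L a = Some (map tyof ts) \<longrightarrow> candidate R (M a ts))"

definition premodel_of ::
  "'c::term_signature trules \<Rightarrow> ('c, 'p) arules \<Rightarrow> 'p lang \<Rightarrow> ('p \<Rightarrow> ('c, 'p) pred) \<Rightarrow> bool" where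
  "premodel_of R A L M \<longleftrightarrow> premodel R L M \<and>
    (\<forall>P Q E. wff L P \<longrightarrow> wff L Q \<longrightarrow> fcong R A P Q \<longrightarrow>
       (\<forall>\<sigma>s k. pred_candidate R (E \<sigma>s k)) \<longrightarrow> interp R M E P = interp R M E Q)"

end

theory Submission
  imports Defs
begin

text \<open>Reduction, and hence the notion of candidate, depends only on the term rewrite rules, so the
  extension changes neither.  The new atoms are interpreted by recursion on \<open>\<prec>\<close>: an atom congruent
  to an instance of the left-hand side of a new rule is interpreted as the corresponding instance
  of the right-hand side, any other new atom as the set of all strongly normalizable terms.
  The recursion is justified because the interpretation of a formula only depends on that of the
  atoms that may occur in it, and condition (1) makes the choice of the rule instance irrelevant
  once the interpretation is known to respect the old congruence.  It produces candidates because
  the interpretation of a formula other than an atom or a predicate variable is a candidate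
  whatever the interpretations of its parts.\<close>

section \<open>Substitution\<close>

lemma tyof_subst [simp]: "tyof (subst \<theta> t) = tyof t"
proof (transfer, goal_cases)
  case (1 \<theta> t)
  then show ?case by (metis conv_typeof typeof_subst_raw)
qed

lemma tyof_lam [simp]: "tyof (lam \<tau> t) = Fun \<tau> (tyof t)"
proof (transfer, goal_cases)
  case (1 \<tau> t)
  then show ?case by (auto dest: conv_typeof)
qed

lemma tyof_app: "tyof s = Fun (tyof t) \<tau> \<Longrightarrow> tyof (app s t) = \<tau>"
proof (transfer, goal_cases)
  case (1 s t \<tau>)
  then show ?case by (auto dest!: conv_typeof)
qed

lemma subst_subst: "subst \<theta> (subst \<eta> t) = subst (scomp \<eta> \<theta>) t"
proof (transfer, goal_cases)
  case (1 \<theta> \<eta> t)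
  then show ?case
    by (metis (mono_tags, lifting) conv_subst_raw subst_raw_subst_raw)
qed

text \<open>Typing is essential: \<open>app\<close> sends an ill-typed pair to the default variable
  \<open>Var (Base 0) 0\<close>, which \<open>\<theta>\<close> may replace, whereas the right-hand
  side would stay at that variable.\<close>

lemma subst_app:
  "tyof s = Fun (tyof t) \<tau> \<Longrightarrow> subst \<theta> (app s t) = app (subst \<theta> s) (subst \<theta> t)"
proof (transfer, goal_cases)
  case (1 s t \<tau> \<theta>)
  then obtain \<sigma> where t: "typeof t = Some \<sigma>" and s: "typeof s = Some (Fun \<sigma> \<tau>)"
    by (auto dest!: conv_typeof)
  have "typeof (\<theta> \<sigma> i) = Some \<sigma>" for \<sigma> i
    using 1 conv_typeof by blast
  then have "typeof (subst_raw \<theta> t) = Some \<sigma>" "typeof (subst_raw \<theta> s) = Some (Fun \<sigma> \<tau>)"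
    using s t by (simp_all add: typeof_subst_raw)
  then show ?case
    using s t by (auto intro!: exI [of _ \<tau>] conv_refl)
qed

lemma up_raw_conv:
  assumes "\<forall>\<sigma> i. conv (\<theta> \<sigma> i) (\<theta> \<sigma> i) \<sigma>"
  shows "conv (up_raw \<tau> \<theta> \<sigma> i) (up_raw \<tau> \<theta> \<sigma> i) \<sigma>"
  using assms by (auto simp: up_raw_def scons_raw_def conv_ren conv_var split: nat.split)

lemma subst_lam: "subst \<theta> (lam \<tau> t) = lam \<tau> (subst (up \<tau> \<theta>) t)"
  unfolding up_def
proof (transfer, goal_cases)
  case (1 \<theta> \<tau> t)
  then obtain \<sigma> where t: "conv t t \<sigma>" by blast
  have "conv (subst_raw (up_raw \<tau> \<theta>) t) (subst_raw (up_raw \<tau> \<theta>) t) \<sigma>"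
    using t up_raw_conv [OF 1(1)] by (rule conv_subst_raw)
  then show ?case
    by (auto simp: ren_as_subst_raw [symmetric] up_raw_def [symmetric] intro: conv_lam)
qed

lemma scomp_up: "scomp (up \<tau> \<eta>) (up \<tau> \<theta>) = up \<tau> (scomp \<eta> \<theta>)"
  unfolding up_def
proof (transfer, goal_cases)
  case (1 \<tau> \<eta> \<theta>)
  have eq: "subst_raw (up_raw \<tau> \<theta>) (up_raw \<tau> \<eta> \<sigma> i) = up_raw \<tau> (\<lambda>\<sigma> i. subst_raw \<theta> (\<eta> \<sigma> i)) \<sigma> i"
    for \<sigma> i
    by (simp add: up_raw_def [of _ \<eta>] up_raw_def [of _ "\<lambda>\<sigma> i. subst_raw \<theta> (\<eta> \<sigma> i)"]
         scons_raw_def subst_raw_up_shift split: nat.splits)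
       (simp add: up_raw_def scons_raw_def)
  have "conv (subst_raw \<theta> (\<eta> \<sigma> i)) (subst_raw \<theta> (\<eta> \<sigma> i)) \<sigma>" for \<sigma> i
    using 1 by (blast intro: conv_subst_raw)
  then have "conv (up_raw \<tau> (\<lambda>\<sigma> i. subst_raw \<theta> (\<eta> \<sigma> i)) \<sigma> i)
      (up_raw \<tau> (\<lambda>\<sigma> i. subst_raw \<theta> (\<eta> \<sigma> i)) \<sigma> i) \<sigma>" for \<sigma> i
    by (simp add: up_raw_conv)
  then show ?case
    by (simp add: ren_as_subst_raw [symmetric] up_raw_def [symmetric] eq)
qed

lemma scomp_up_scons: "scomp (up (tyof t) \<theta>) (scons t \<eta>) = scons t (scomp \<theta> \<eta>)"
  unfolding up_def
proof (transfer, goal_cases)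
  case (1 t \<theta> \<eta>)
  then obtain \<tau> where t: "conv t t \<tau>" by blast
  have \<tau>: "typeof t = Some \<tau>" using conv_typeof [OF t] by simp
  \<comment> \<open>The shift skips exactly the index that \<open>scons_raw\<close> fills, so the
    two cancel and leave \<open>\<eta>\<close>.\<close>
  have cancel: "subst_raw (scons_raw \<tau> t \<eta>) (ren (shift_ren [\<tau>]) s) = subst_raw \<eta> s" for s
  proof -
    have "(\<lambda>\<sigma> i. scons_raw \<tau> t \<eta> \<sigma> (shift_ren [\<tau>] \<sigma> i)) = \<eta>"
      by (auto simp: scons_raw_def shift_ren_def fun_eq_iff)
    then show ?thesis by (simp add: subst_raw_ren)
  qed
  have eq: "subst_raw (scons_raw \<tau> t \<eta>) (up_raw \<tau> \<theta> \<sigma> i) =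
      scons_raw \<tau> t (\<lambda>\<sigma> i. subst_raw \<eta> (\<theta> \<sigma> i)) \<sigma> i" for \<sigma> i
    by (simp add: up_raw_def scons_raw_def [of _ "Var \<tau> 0"] cancel split: nat.splits)
       (simp add: scons_raw_def split: nat.splits)
  have "conv (subst_raw \<eta> (\<theta> \<sigma> i)) (subst_raw \<eta> (\<theta> \<sigma> i)) \<sigma>" for \<sigma> i
    using 1 by (blast intro: conv_subst_raw)
  then show ?case
    using t
    by (auto simp: \<tau> ren_as_subst_raw [symmetric] up_raw_def [symmetric] eq)
       (auto simp: scons_raw_def split: nat.split)
qed

lemma scomp_ids [simp]: "scomp \<theta> ids = \<theta>"
  unfolding ids_def
proof (transfer, goal_cases)
  case (1 \<theta>)
  have "(\<lambda>\<sigma> i. Var \<sigma> (shift_ren [] \<sigma> i)) = (Var :: ty \<Rightarrow> nat \<Rightarrow> 'a trm)"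
    by (simp add: shift_ren_def fun_eq_iff)
  with 1 show ?case by (simp add: subst_raw_Var)
qed

lemma scomp_ups: "scomp (ups \<tau>s \<eta>) (ups \<tau>s \<theta>) = ups \<tau>s (scomp \<eta> \<theta>)"
  by (induction \<tau>s arbitrary: \<eta> \<theta>) (simp_all add: ups_def scomp_up)

lemma scomp_ups_fold_scons:
  "scomp (ups (map tyof ts) \<theta>) (fold scons ts \<eta>) = fold scons ts (scomp \<theta> \<eta>)"
  by (induction ts arbitrary: \<theta> \<eta>) (simp_all add: ups_def scomp_up_scons)

text \<open>The preceding law with \<open>ids\<close> for \<open>\<eta>\<close>. It merges the
  instantiation of outer variables with that of inner bound ones, as nested binders require.\<close>

lemma scomp_ups_inst: "scomp (ups (map tyof ts) (inst us)) (inst ts) = inst (us @ ts)"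
  using scomp_ups_fold_scons [of ts "inst us" ids] by (simp add: inst_def)

lemma fsubst_fsubst: "fsubst \<theta> (fsubst \<eta> P) = fsubst (scomp \<eta> \<theta>) P"
  by (induction P arbitrary: \<theta> \<eta>) (simp_all add: subst_subst scomp_up scomp_ups)

lemma polar_fsubst [simp]: "polar b \<sigma>s k (fsubst \<theta> P) = polar b \<sigma>s k P"
  by (induction P arbitrary: \<theta> b k) simp_all

lemma wff_fsubst [simp]: "wff L (fsubst \<theta> P) = wff L P"
  by (induction P arbitrary: \<theta>) (simp_all add: comp_def)

lemma pvar_occurs_fsubst [simp]: "pvar_occurs \<sigma>s k (fsubst \<theta> P) = pvar_occurs \<sigma>s k P"
  by (induction P arbitrary: \<theta> k) simp_all

section \<open>Term congruence: types and substitution\<close>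

lemma tcong_tyof:
  assumes "wf_trules R" and "tcong R s t"
  shows "tyof s = tyof t"
  using assms(2)
proof (induction rule: tcong.induct)
  case (tcong_rule l r \<theta>)
  then show ?case using assms(1) by (auto simp: wf_trules_def)
next
  case (tcong_app s s' t t' \<tau>)
  then have "tyof s' = Fun (tyof t') \<tau>" by simp
  with tcong_app show ?case by (simp only: tyof_app)
qed simp_all

lemma tcong_subst:
  assumes "wf_trules R" and "tcong R s t"
  shows "tcong R (subst \<theta> s) (subst \<theta> t)"
  using assms(2)
proof (induction arbitrary: \<theta> rule: tcong.induct)
  case (tcong_rule l r \<eta>)
  then show ?case by (simp add: subst_subst tcong.tcong_rule)
next
  case (tcong_trans s t u)
  then show ?case by (blast intro: tcong.tcong_trans)
next
  case (tcong_app s s' t t' \<tau>)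
  \<comment> \<open>The congruence preserves types, so the right-hand application is well typed too
    and \<open>subst_app\<close> applies to both sides.\<close>
  have "tyof s' = Fun (tyof t') \<tau>"
    using tcong_app assms(1) by (metis tcong_tyof)
  then show ?case
    using tcong_app by (auto simp: subst_app intro: tcong.tcong_app)
qed (auto simp: subst_lam intro: tcong.intros)

lemma tscong_subst:
  "wf_trules R \<Longrightarrow> tscong R ts us \<Longrightarrow> tscong R (map (subst \<theta>) ts) (map (subst \<theta>) us)"
  by (auto simp: list_all2_conv_all_nth tcong_subst)

lemma tscong_tyof: "wf_trules R \<Longrightarrow> tscong R ts us \<Longrightarrow> map tyof ts = map tyof us"
  by (auto simp: list_all2_conv_all_nth tcong_tyof list_eq_iff_nth_eq)

lemma subst_ids [simp]: "subst ids t = t"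
  unfolding ids_def
proof (transfer, goal_cases)
  case (1 t)
  have "(\<lambda>\<sigma> i. Var \<sigma> (shift_ren [] \<sigma> i)) = (Var :: ty \<Rightarrow> nat \<Rightarrow> 'a trm)"
    by (simp add: shift_ren_def fun_eq_iff)
  with 1 show ?case by (simp add: subst_raw_Var)
qed

lemma up_ids [simp]: "up \<tau> ids = ids"
  unfolding up_def ids_def
  by transfer (auto simp: scons_raw_def shift_ren_def intro: conv_var split: nat.split)

lemma ups_ids [simp]: "ups \<tau>s ids = ids"
  by (induction \<tau>s) (simp_all add: ups_def)

lemma fsubst_ids [simp]: "fsubst ids P = P"
  by (induction P) (simp_all add: map_idI)

lemma ups_Cons: "ups (\<tau> # \<tau>s) \<theta> = ups \<tau>s (up \<tau> \<theta>)"
  by (simp add: ups_def)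

lemma ups_append: "ups (\<sigma>s @ \<tau>s) \<theta> = ups \<tau>s (ups \<sigma>s \<theta>)"
  by (simp add: ups_def)

section \<open>Occurrences in instances of a formula\<close>

lemma occurs_in_wff: "occurs_in \<sigma>s P' P \<Longrightarrow> wff L P \<Longrightarrow> wff L P'"
  by (induction rule: occurs_in.induct) simp_all

text \<open>A term substitution changes no connective, binder or predicate symbol, so each
  subformula of the instance comes from one at the same position, with \<open>\<theta>\<close>
  lifted over the binders on the way.\<close>

lemma occurs_in_fsubst:
  assumes "occurs_in \<sigma>s P' (fsubst \<theta> P)"
  shows "\<exists>P''. occurs_in \<sigma>s P'' P \<and> P' = fsubst (ups \<sigma>s \<theta>) P''"
  using assms
proof (induction \<sigma>s P' "fsubst \<theta> P" arbitrary: P \<theta> rule: occurs_in.induct)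
  case (1 P)
  then show ?case by (auto simp: ups_def intro: occurs_in.intros)
next
  case (2 \<tau>s P' P1 Q1)
  then show ?case by (cases P) (auto, metis occurs_in.intros(2))
next
  case (3 \<tau>s P' P1 Q1)
  then show ?case by (cases P) (auto, metis occurs_in.intros(3))
next
  case (4 \<tau>s P' P1 Q1)
  then show ?case by (cases P) (auto, metis occurs_in.intros(4))
next
  case (5 \<tau>s P' P1 Q1)
  then show ?case by (cases P) (auto, metis occurs_in.intros(5))
next
  case (6 \<tau>s P' P1 Q1)
  then show ?case by (cases P) (auto, metis occurs_in.intros(6))
next
  case (7 \<tau>s P' P1 Q1)
  then show ?case by (cases P) (auto, metis occurs_in.intros(7))
next
  case (8 \<tau>s P' P1 \<tau>)
  then show ?case by (cases P) (auto simp: ups_Cons ups_append, metis occurs_in.intros(8))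
next
  case (9 \<tau>s P' P1 \<tau>)
  then show ?case by (cases P) (auto simp: ups_Cons ups_append, metis occurs_in.intros(9))
next
  case (10 \<tau>s P' P1 \<sigma>s ts)
  then show ?case by (cases P) (auto simp: ups_Cons ups_append, metis occurs_in.intros(10))
next
  case (11 \<tau>s P' P1 \<sigma>s ts)
  then show ?case by (cases P) (auto simp: ups_Cons ups_append, metis occurs_in.intros(11))
qed

lemma may_occur_in_fsubst_inst:
  assumes "may_occur_in Q (fsubst (inst us) P)"
  obtains P' ts where "occurs_in (map tyof ts) P' P" "Q = fsubst (inst (us @ ts)) P'"
proof -
  from assms obtain P' ts where "occurs_in (map tyof ts) P' (fsubst (inst us) P)"
    and Q: "Q = fsubst (inst ts) P'"
    by (auto simp: may_occur_in_def)
  then obtain P'' where P'': "occurs_in (map tyof ts) P'' P"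
      "P' = fsubst (ups (map tyof ts) (inst us)) P''"
    using occurs_in_fsubst by blast
  with Q have "Q = fsubst (inst (us @ ts)) P''"
    by (simp add: fsubst_fsubst scomp_ups_inst)
  with P''(1) show thesis by (rule that)
qed

text \<open>The witness \<open>t\<close> is put in front of the terms that instantiate the deeper
  binders; the type condition matches what \<open>occurs_in\<close> records for the bound
  variable.\<close>

lemma may_occur_in_All:
  assumes "may_occur_in Q (fsubst (inst [t]) P)" and "tyof t = \<tau>"
  shows "may_occur_in Q (All \<tau> P)"
proof -
  obtain P' ts where "occurs_in (map tyof ts) P' P" "Q = fsubst (inst ([t] @ ts)) P'"
    using assms(1) by (rule may_occur_in_fsubst_inst)
  then show ?thesis
    unfolding may_occur_in_def using assms(2)
    by (auto intro!: exI [of _ P'] exI [of _ "t # ts"] occurs_in.intros)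
qed

lemma may_occur_in_Ex:
  assumes "may_occur_in Q (fsubst (inst [t]) P)" and "tyof t = \<tau>"
  shows "may_occur_in Q (Ex \<tau> P)"
proof -
  obtain P' ts where "occurs_in (map tyof ts) P' P" "Q = fsubst (inst ([t] @ ts)) P'"
    using assms(1) by (rule may_occur_in_fsubst_inst)
  then show ?thesis
    unfolding may_occur_in_def using assms(2)
    by (auto intro!: exI [of _ P'] exI [of _ "t # ts"] occurs_in.intros)
qed

lemma may_occur_in_Mu:
  assumes "may_occur_in Q (fsubst (inst us) P)" and "map tyof us = \<tau>s"
  shows "may_occur_in Q (Mu \<tau>s P vs)"
proof -
  obtain P' ts where "occurs_in (map tyof ts) P' P" "Q = fsubst (inst (us @ ts)) P'"
    using assms(1) by (rule may_occur_in_fsubst_inst)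
  then show ?thesis
    unfolding may_occur_in_def using assms(2)
    by (auto intro!: exI [of _ P'] exI [of _ "us @ ts"] occurs_in.intros)
qed

lemma may_occur_in_Nu:
  assumes "may_occur_in Q (fsubst (inst us) P)" and "map tyof us = \<tau>s"
  shows "may_occur_in Q (Nu \<tau>s P vs)"
proof -
  obtain P' ts where "occurs_in (map tyof ts) P' P" "Q = fsubst (inst (us @ ts)) P'"
    using assms(1) by (rule may_occur_in_fsubst_inst)
  then show ?thesis
    unfolding may_occur_in_def using assms(2)
    by (auto intro!: exI [of _ P'] exI [of _ "us @ ts"] occurs_in.intros)
qed

lemma may_occur_in_connectives:
  "may_occur_in S P \<or> may_occur_in S Q \<Longrightarrow> may_occur_in S (Imp P Q)"
  "may_occur_in S P \<or> may_occur_in S Q \<Longrightarrow> may_occur_in S (Conj P Q)"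
  "may_occur_in S P \<or> may_occur_in S Q \<Longrightarrow> may_occur_in S (Disj P Q)"
  unfolding may_occur_in_def by (blast intro: occurs_in.intros)+

lemma may_occur_in_self: "may_occur_in P P"
  unfolding may_occur_in_def
  by (rule exI [of _ P], rule exI [of _ "[]"]) (simp add: inst_def occurs_in.intros)

lemma may_occur_in_wff: "may_occur_in Q P \<Longrightarrow> wff L P \<Longrightarrow> wff L Q"
  by (auto simp: may_occur_in_def dest: occurs_in_wff)

section \<open>Candidates\<close>

lemma SN_I: "(\<And>\<pi>'. step R \<pi> \<pi>' \<Longrightarrow> \<pi>' \<in> SN R) \<Longrightarrow> \<pi> \<in> SN R"
  by (auto simp: SN_def intro: accp.accI)

lemma SN_step: "\<pi> \<in> SN R \<Longrightarrow> step R \<pi> \<pi>' \<Longrightarrow> \<pi>' \<in> SN R"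
  by (auto simp: SN_def intro: accp_downward)

lemma candidate_SN: "candidate R (SN R)"
  by (auto simp: candidate_def intro: SN_I SN_step)

lemma candidate_subset_SN: "candidate R C \<Longrightarrow> C \<subseteq> SN R"
  by (simp add: candidate_def)

lemma candidate_Inter:
  assumes "\<C> \<noteq> {}" and "\<And>C. C \<in> \<C> \<Longrightarrow> candidate R C"
  shows "candidate R (\<Inter>\<C>)"
  using assms unfolding candidate_def by blast

text \<open>Closure under reduction holds because the condition speaks of all reducts. From a
  neutral term, a reduction sequence is either empty, where the assumption on \<open>G\<close>
  applies, or starts with a step into the set.\<close>

lemma candidate_steps:
  assumes "\<And>\<pi>. neutral \<pi> \<Longrightarrow> G \<pi>"
  shows "candidate R {\<pi> \<in> SN R. \<forall>\<pi>'. steps R \<pi> \<pi>' \<longrightarrow> G \<pi>'}"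
  unfolding candidate_def
proof (intro conjI allI impI)
  fix \<pi> \<pi>'
  assume "\<pi> \<in> {\<pi> \<in> SN R. \<forall>\<pi>'. steps R \<pi> \<pi>' \<longrightarrow> G \<pi>'}" "step R \<pi> \<pi>'"
  then show "\<pi>' \<in> {\<pi> \<in> SN R. \<forall>\<pi>'. steps R \<pi> \<pi>' \<longrightarrow> G \<pi>'}"
    by (auto intro: SN_step converse_rtranclp_into_rtranclp)
next
  fix \<pi> :: "('a, 'b) pf"
  assume "neutral \<pi>"
    and *: "\<forall>\<pi>'. step R \<pi> \<pi>' \<longrightarrow> \<pi>' \<in> {\<pi> \<in> SN R. \<forall>\<pi>'. steps R \<pi> \<pi>' \<longrightarrow> G \<pi>'}"
  then show "\<pi> \<in> {\<pi> \<in> SN R. \<forall>\<pi>'. steps R \<pi> \<pi>' \<longrightarrow> G \<pi>'}"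
    using assms by (auto intro: SN_I elim: converse_rtranclpE)
qed auto

text \<open>Introduction forms are not neutral, so each condition holds vacuously at a neutral term.
  The predicates \<open>G1\<close> to \<open>G7\<close> are arbitrary: nothing is asked of the
  interpretations of the components.\<close>

lemma candidate_intro_clauses:
  fixes R :: "'c::term_signature trules"
    and G1 G3 G4 G5 :: "('c, 'p) pf \<Rightarrow> bool" and G2 G7 :: "('c, 'p) pf \<Rightarrow> ('c, 'p) pf \<Rightarrow> bool"
    and G6 :: "'c tm \<Rightarrow> ('c, 'p) pf \<Rightarrow> bool"
  shows
  "candidate R {\<pi> \<in> SN R. \<forall>\<pi>1. steps R \<pi> (PAbs \<pi>1) \<longrightarrow> G1 \<pi>1}"
  "candidate R {\<pi> \<in> SN R. \<forall>\<pi>1 \<pi>2. steps R \<pi> (Pair \<pi>1 \<pi>2) \<longrightarrow> G2 \<pi>1 \<pi>2}"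
  "candidate R {\<pi> \<in> SN R. (\<forall>\<pi>1. steps R \<pi> (In1 \<pi>1) \<longrightarrow> G3 \<pi>1) \<and>
     (\<forall>\<pi>2. steps R \<pi> (In2 \<pi>2) \<longrightarrow> G4 \<pi>2)}"
  "candidate R {\<pi> \<in> SN R. \<forall>\<pi>1. steps R \<pi> (TAbs \<tau> \<pi>1) \<longrightarrow> G5 \<pi>1}"
  "candidate R {\<pi> \<in> SN R. \<forall>t \<pi>1. steps R \<pi> (Wit t \<pi>1) \<longrightarrow> G6 t \<pi>1}"
  "candidate R {\<pi> \<in> SN R. \<forall>\<pi>1 \<pi>2. steps R \<pi> (NuI \<tau>s \<pi>1 \<pi>2) \<longrightarrow> G7 \<pi>1 \<pi>2}"
proof -
  have *: "candidate R C" if "\<And>\<pi>. neutral \<pi> \<Longrightarrow> G \<pi>"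
    and "C = {\<pi> \<in> SN R. \<forall>\<pi>'. steps R \<pi> \<pi>' \<longrightarrow> G \<pi>'}" for C and G :: "('c, 'p) pf \<Rightarrow> bool"
    using candidate_steps [of G R] that by simp
  show "candidate R {\<pi> \<in> SN R. \<forall>\<pi>1. steps R \<pi> (PAbs \<pi>1) \<longrightarrow> G1 \<pi>1}"
    by (rule * [of "\<lambda>\<pi>'. \<forall>\<pi>1. \<pi>' = PAbs \<pi>1 \<longrightarrow> G1 \<pi>1"]) auto
  show "candidate R {\<pi> \<in> SN R. \<forall>\<pi>1 \<pi>2. steps R \<pi> (Pair \<pi>1 \<pi>2) \<longrightarrow> G2 \<pi>1 \<pi>2}"
    by (rule * [of "\<lambda>\<pi>'. \<forall>\<pi>1 \<pi>2. \<pi>' = Pair \<pi>1 \<pi>2 \<longrightarrow> G2 \<pi>1 \<pi>2"]) auto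
  show "candidate R {\<pi> \<in> SN R. (\<forall>\<pi>1. steps R \<pi> (In1 \<pi>1) \<longrightarrow> G3 \<pi>1) \<and>
     (\<forall>\<pi>2. steps R \<pi> (In2 \<pi>2) \<longrightarrow> G4 \<pi>2)}"
    by (rule * [of "\<lambda>\<pi>'. (\<forall>\<pi>1. \<pi>' = In1 \<pi>1 \<longrightarrow> G3 \<pi>1) \<and> (\<forall>\<pi>2. \<pi>' = In2 \<pi>2 \<longrightarrow> G4 \<pi>2)"])
       auto
  show "candidate R {\<pi> \<in> SN R. \<forall>\<pi>1. steps R \<pi> (TAbs \<tau> \<pi>1) \<longrightarrow> G5 \<pi>1}"
    by (rule * [of "\<lambda>\<pi>'. \<forall>\<pi>1. \<pi>' = TAbs \<tau> \<pi>1 \<longrightarrow> G5 \<pi>1"]) auto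
  show "candidate R {\<pi> \<in> SN R. \<forall>t \<pi>1. steps R \<pi> (Wit t \<pi>1) \<longrightarrow> G6 t \<pi>1}"
    by (rule * [of "\<lambda>\<pi>'. \<forall>t \<pi>1. \<pi>' = Wit t \<pi>1 \<longrightarrow> G6 t \<pi>1"]) auto
  show "candidate R {\<pi> \<in> SN R. \<forall>\<pi>1 \<pi>2. steps R \<pi> (NuI \<tau>s \<pi>1 \<pi>2) \<longrightarrow> G7 \<pi>1 \<pi>2}"
    by (rule * [of "\<lambda>\<pi>'. \<forall>\<pi>1 \<pi>2. \<pi>' = NuI \<tau>s \<pi>1 \<pi>2 \<longrightarrow> G7 \<pi>1 \<pi>2"]) auto
qed

text \<open>The bottom candidate. It is not empty: a proof variable is neutral and has no reducts,
  hence lies in every candidate.\<close>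

definition least_cand :: "'c::term_signature trules \<Rightarrow> ('c, 'p) pf set" where
  "least_cand R = \<Inter> {C. candidate R C}"

lemma candidate_least_cand: "candidate R (least_cand R)"
  unfolding least_cand_def by (rule candidate_Inter) (auto intro: candidate_SN)

lemma least_cand_subset: "candidate R C \<Longrightarrow> least_cand R \<subseteq> C"
  by (auto simp: least_cand_def)

section \<open>Predicate candidates and fixed points\<close>

lemma pred_candidate_SN: "pred_candidate R (\<lambda>ts. SN R)"
  by (simp add: pred_candidate_def candidate_SN)

lemma pred_candidate_subset_SN: "pred_candidate R X \<Longrightarrow> X ts \<subseteq> SN R"
  by (simp add: pred_candidate_def candidate_subset_SN)

lemma pred_candidate_cong: "pred_candidate R X \<Longrightarrow> tscong R ts us \<Longrightarrow> X ts = X us"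
  by (simp add: pred_candidate_def)

text \<open>Congruent tuples have the same types, so overwriting the values at all tuples of other
  types keeps invariance.\<close>

lemma pred_candidate_typed:
  assumes "wf_trules R" and "pred_candidate R X" and "candidate R C"
  shows "pred_candidate R (\<lambda>ts. if map tyof ts = \<tau>s then X ts else C)"
  unfolding pred_candidate_def
proof (intro conjI allI impI)
  fix ts us
  assume "tscong R ts us"
  with assms show "(if map tyof ts = \<tau>s then X ts else C) = (if map tyof us = \<tau>s then X us else C)"
    using tscong_tyof [of R ts us] pred_candidate_cong [of R X ts us] by simp
qed (use assms in \<open>simp add: pred_candidate_def\<close>)

lemma candidate_lfp_cand:
  assumes "\<And>X us. \<Phi> X us \<subseteq> SN R"
  shows "candidate R (lfp_cand R \<Phi> ts)"
  unfolding lfp_cand_def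
proof (rule candidate_Inter)
  \<comment> \<open>The constant function \<open>SN R\<close> is a pre-fixed point, so the
    intersection is over a nonempty family.\<close>
  have "SN R \<in> {X ts | X. pred_candidate R X \<and> \<Phi> X \<le> X}"
    using assms pred_candidate_SN by (auto simp: le_fun_def intro!: exI [of _ "\<lambda>_. SN R"])
  then show "{X ts | X. pred_candidate R X \<and> \<Phi> X \<le> X} \<noteq> {}" by blast
qed (auto simp: pred_candidate_def)

lemma candidate_gfp_cand: "candidate R (gfp_cand R \<Phi> ts)"
  unfolding gfp_cand_def
proof (rule candidate_Inter)
  have "SN R \<in> {Z ts | Z. pred_candidate R Z \<and>
      (\<forall>X. pred_candidate R X \<longrightarrow> X \<le> \<Phi> X \<longrightarrow> X \<le> Z)}"
    using pred_candidate_SN pred_candidate_subset_SN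
    by (fastforce simp: le_fun_def intro!: exI [of _ "\<lambda>_. SN R"])
  then show "{Z ts | Z. pred_candidate R Z \<and>
      (\<forall>X. pred_candidate R X \<longrightarrow> X \<le> \<Phi> X \<longrightarrow> X \<le> Z)} \<noteq> {}" by blast
qed (auto simp: pred_candidate_def)

text \<open>Introduction clauses and fixed points give candidates by their form alone, so a case
  split suffices and \<open>M\<close> is asked for a candidate only if \<open>P\<close> itself is an
  atom.\<close>

lemma candidate_interp:
  assumes "\<And>\<sigma>s k. pred_candidate R (E \<sigma>s k)"
    and "\<And>a ts. P = Atom a ts \<Longrightarrow> candidate R (M a ts)"
  shows "candidate R (interp R M E P)"
proof (cases P)
  case (Mu \<tau>s Q ts)
  show ?thesis unfolding Mu interp.simps by (rule candidate_lfp_cand) auto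
next
  case (Ex \<tau> Q)
  show ?thesis unfolding Ex interp.simps by (rule candidate_intro_clauses)
next
  case (PVar \<tau>s k ts)
  with assms(1) [of \<tau>s k] show ?thesis by (simp add: pred_candidate_def)
qed (use assms(2) in \<open>simp_all add: candidate_SN candidate_intro_clauses candidate_gfp_cand\<close>)

lemma lfp_cand_cong:
  assumes "\<And>X. pred_candidate R X \<Longrightarrow> \<Phi> X = \<Psi> X" and "tscong R ts us"
  shows "lfp_cand R \<Phi> ts = lfp_cand R \<Psi> us"
proof -
  have "{X ts | X. pred_candidate R X \<and> \<Phi> X \<le> X} = {X us | X. pred_candidate R X \<and> \<Psi> X \<le> X}"
    unfolding setcompr_eq_image
    using assms(1) pred_candidate_cong [OF _ assms(2)] by (intro image_cong) auto
  then show ?thesis by (simp add: lfp_cand_def)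
qed

lemma gfp_cand_cong:
  assumes "\<And>X. pred_candidate R X \<Longrightarrow> \<Phi> X = \<Psi> X" and "tscong R ts us"
  shows "gfp_cand R \<Phi> ts = gfp_cand R \<Psi> us"
proof -
  have "(\<forall>X. pred_candidate R X \<longrightarrow> X \<le> \<Phi> X \<longrightarrow> X \<le> Z) =
      (\<forall>X. pred_candidate R X \<longrightarrow> X \<le> \<Psi> X \<longrightarrow> X \<le> Z)" for Z
    using assms(1) by auto
  then have "{Z ts | Z. pred_candidate R Z \<and> (\<forall>X. pred_candidate R X \<longrightarrow> X \<le> \<Phi> X \<longrightarrow> X \<le> Z)} =
      {Z us | Z. pred_candidate R Z \<and> (\<forall>X. pred_candidate R X \<longrightarrow> X \<le> \<Psi> X \<longrightarrow> X \<le> Z)}"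
    unfolding setcompr_eq_image
    by (intro image_cong) (simp, rule pred_candidate_cong [OF _ assms(2)], simp)
  then show ?thesis by (simp add: gfp_cand_def)
qed

text \<open>The operator of a fixed-point formula is also applied to tuples of the wrong types or length,
  whose instances are not among those that \<^const>\<open>may_occur_in\<close> takes into account.  Such tuples do not matter:
  a pre-fixed point can be enlarged there to \<^const>\<open>SN\<close>, a post-fixed point shrunk to the least
  candidate.\<close>

lemma lfp_cand_mono_typed:
  assumes "wf_trules R" and "map tyof ts = \<tau>s"
    and eq: "\<And>X Y us. pred_candidate R X \<Longrightarrow> pred_candidate R Y \<Longrightarrow>
      (\<And>vs. map tyof vs = \<tau>s \<Longrightarrow> X vs = Y vs) \<Longrightarrow> map tyof us = \<tau>s \<Longrightarrow> \<Phi> X us = \<Psi> Y us"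
    and SN: "\<And>X us. \<Psi> X us \<subseteq> SN R"
  shows "lfp_cand R \<Psi> ts \<subseteq> lfp_cand R \<Phi> ts"
proof -
  have "lfp_cand R \<Psi> ts \<subseteq> X ts" if X: "pred_candidate R X" "\<Phi> X \<le> X" for X
  proof -
    \<comment> \<open>\<open>eq\<close> says nothing at tuples of other types; with the value
      \<open>SN R\<close> the pre-fixed-point inequality is automatic there, while the value at
      \<open>ts\<close> is unchanged.\<close>
    define Y where "Y = (\<lambda>us. if map tyof us = \<tau>s then X us else SN R)"
    have Y: "pred_candidate R Y"
      unfolding Y_def using assms(1) X(1) candidate_SN by (rule pred_candidate_typed)
    have "\<Psi> Y us \<subseteq> Y us" for us
    proof (cases "map tyof us = \<tau>s")
      case True
      then have "\<Phi> X us = \<Psi> Y us" using X(1) Y by (intro eq) (simp_all add: Y_def)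
      then show ?thesis using X(2) True by (auto simp: Y_def le_fun_def)
    next
      case False
      then show ?thesis using SN by (simp add: Y_def)
    qed
    then have "lfp_cand R \<Psi> ts \<subseteq> Y ts"
      using Y by (auto simp: lfp_cand_def le_fun_def)
    then show ?thesis using assms(2) by (simp add: Y_def)
  qed
  then show ?thesis unfolding lfp_cand_def by blast
qed

lemma gfp_cand_mono_typed:
  assumes "wf_trules R" and "map tyof ts = \<tau>s"
    and eq: "\<And>X Y us. pred_candidate R X \<Longrightarrow> pred_candidate R Y \<Longrightarrow>
      (\<And>vs. map tyof vs = \<tau>s \<Longrightarrow> X vs = Y vs) \<Longrightarrow> map tyof us = \<tau>s \<Longrightarrow> \<Phi> X us = \<Psi> Y us"
    and cand: "\<And>X us. candidate R (\<Phi> X us)"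
  shows "gfp_cand R \<Psi> ts \<subseteq> gfp_cand R \<Phi> ts"
proof -
  have "gfp_cand R \<Psi> ts \<subseteq> Z ts"
    if Z: "pred_candidate R Z" "\<forall>X. pred_candidate R X \<longrightarrow> X \<le> \<Phi> X \<longrightarrow> X \<le> Z" for Z
  proof -
    \<comment> \<open>At tuples of other types \<open>Z\<close> is only known to dominate a shrunk
      version of \<open>X\<close>; raising it to \<open>SN R\<close> there makes it dominate
      \<open>X\<close> itself.\<close>
    define Z' where "Z' = (\<lambda>us. if map tyof us = \<tau>s then Z us else SN R)"
    have Z': "pred_candidate R Z'"
      unfolding Z'_def using assms(1) Z(1) candidate_SN by (rule pred_candidate_typed)
    have "X \<le> Z'" if X: "pred_candidate R X" "X \<le> \<Psi> X" for X
    proof -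
      \<comment> \<open>The bottom candidate at the other tuples makes \<open>Y\<close> post-fixed
        there, since every value of \<open>\<Phi>\<close> is a candidate.\<close>
      define Y where "Y = (\<lambda>us. if map tyof us = \<tau>s then X us else least_cand R)"
      have Y: "pred_candidate R Y"
        unfolding Y_def using assms(1) X(1) candidate_least_cand by (rule pred_candidate_typed)
      have "Y us \<subseteq> \<Phi> Y us" for us
      proof (cases "map tyof us = \<tau>s")
        case True
        then have "\<Phi> Y us = \<Psi> X us" using X(1) Y by (intro eq) (simp_all add: Y_def)
        then show ?thesis using X(2) True by (auto simp: Y_def le_fun_def)
      next
        case False
        then have "Y us = least_cand R" by (simp add: Y_def)
        then show ?thesis using least_cand_subset [OF cand] by simp
      qed
      then have "Y \<le> Z" using Z(2) Y by (simp add: le_fun_def)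
      then have "Y us \<subseteq> Z us" for us by (simp add: le_fun_def)
      then have "X us \<subseteq> Z' us" for us
        using pred_candidate_subset_SN [OF X(1)]
        by (cases "map tyof us = \<tau>s") (simp_all add: Y_def Z'_def, metis)
      then show ?thesis by (simp add: le_fun_def)
    qed
    then have "gfp_cand R \<Psi> ts \<subseteq> Z' ts"
      using Z' unfolding gfp_cand_def by blast
    then show ?thesis using assms(2) by (simp add: Z'_def)
  qed
  then show ?thesis unfolding gfp_cand_def by blast
qed

section \<open>Dependence of the interpretation on atoms, variables and congruence\<close>

text \<open>Induction on size, because binders are interpreted through instances of their bodies,
  which have the size of the body. Environments are compared only at well-typed tuples, the only
  ones where two candidates for a bound predicate variable are known to agree.\<close>

lemma interp_cong:
  assumes "wf_trules R"
    and "wff L P"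
    and "\<And>a ts. may_occur_in (Atom a ts) P \<Longrightarrow> M a ts = M' a ts"
    and "\<And>\<sigma>s k ts. pvar_occurs \<sigma>s k P \<Longrightarrow> map tyof ts = \<sigma>s \<Longrightarrow> E \<sigma>s k ts = E' \<sigma>s k ts"
  shows "interp R M E P = interp R M' E' P"
  using assms(2-)
proof (induction "size P" arbitrary: P E E' rule: less_induct)
  case less
  note IH = less.hyps and wff = less.prems(1) and atoms = less.prems(2) and pvars = less.prems(3)
  have sub: "interp R M E Q = interp R M' E' Q"
    if "size Q < size P" "wff L Q" "\<And>S. may_occur_in S Q \<Longrightarrow> may_occur_in S P"
      "\<And>\<sigma>s k. pvar_occurs \<sigma>s k Q \<Longrightarrow> pvar_occurs \<sigma>s k P" for Q
    using that(1,2) atoms [OF that(3)] pvars [OF that(4)] by (rule IH)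
  have body: "interp R M (penv_cons \<tau>s X E) (fsubst (inst us) Q) =
      interp R M' (penv_cons \<tau>s Y E') (fsubst (inst us) Q)"
    if P: "P = Mu \<tau>s Q ts \<or> P = Nu \<tau>s Q ts" and us: "map tyof us = \<tau>s"
      and XY: "\<And>vs. map tyof vs = \<tau>s \<Longrightarrow> X vs = Y vs" for \<tau>s Q ts us X Y
  proof (rule IH)
    show "size (fsubst (inst us) Q) < size P" "wff L (fsubst (inst us) Q)"
      using P wff by auto
    show "M a vs = M' a vs" if "may_occur_in (Atom a vs) (fsubst (inst us) Q)" for a vs
    proof (rule atoms)
      show "may_occur_in (Atom a vs) P"
        using that P us may_occur_in_Mu may_occur_in_Nu by blast
    qed
    show "penv_cons \<tau>s X E \<sigma>s k vs = penv_cons \<tau>s Y E' \<sigma>s k vs"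
      if "pvar_occurs \<sigma>s k (fsubst (inst us) Q)" "map tyof vs = \<sigma>s" for \<sigma>s k vs
      \<comment> \<open>Index 0 for \<open>\<tau>s\<close> is the bound predicate variable, covered
        by \<open>XY\<close>; the other indices for \<open>\<tau>s\<close> are one higher than in
        \<open>P\<close>, as \<open>under\<close> records.\<close>
      using that P XY pvars [of \<sigma>s _ vs]
      by (auto simp: penv_cons_def under_def split: nat.split)
  qed
  show ?case
  proof (cases P)
    case (Imp Q1 Q2)
    have "interp R M E Q1 = interp R M' E' Q1" "interp R M E Q2 = interp R M' E' Q2"
      using wff by (intro sub; simp add: Imp may_occur_in_connectives)+
    then show ?thesis by (simp add: Imp)
  next
    case (Conj Q1 Q2)
    have "interp R M E Q1 = interp R M' E' Q1" "interp R M E Q2 = interp R M' E' Q2"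
      using wff by (intro sub; simp add: Conj may_occur_in_connectives)+
    then show ?thesis by (simp add: Conj)
  next
    case (Disj Q1 Q2)
    have "interp R M E Q1 = interp R M' E' Q1" "interp R M E Q2 = interp R M' E' Q2"
      using wff by (intro sub; simp add: Disj may_occur_in_connectives)+
    then show ?thesis by (simp add: Disj)
  next
    case (All \<tau> Q)
    have "interp R M E (fsubst (inst [t]) Q) = interp R M' E' (fsubst (inst [t]) Q)"
      if "tyof t = \<tau>" for t
      using wff that by (intro sub) (auto simp: All intro: may_occur_in_All)
    then show ?thesis by (simp add: All)
  next
    case (Ex \<tau> Q)
    have "interp R M E (fsubst (inst [t]) Q) = interp R M' E' (fsubst (inst [t]) Q)"
      if "tyof t = \<tau>" for t
      using wff that by (intro sub) (auto simp: Ex intro: may_occur_in_Ex)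
    then show ?thesis by (auto simp: Ex)
  next
    case (Mu \<tau>s Q ts)
    then have ts: "map tyof ts = \<tau>s" using wff by simp
    define \<Phi> where "\<Phi> = (\<lambda>M E X us. {\<pi> \<in> SN R. \<forall>S vs \<pi>1. steps R \<pi> (MuI \<tau>s S vs \<pi>1) \<longrightarrow>
      \<pi>1 \<in> interp R M (penv_cons \<tau>s X E) (fsubst (inst us) Q)})"
    have SN: "\<Phi> M E X us \<subseteq> SN R" for M E X us
      unfolding \<Phi>_def by blast
    have eq: "\<Phi> M E X us = \<Phi> M' E' X' us"
      if "map tyof us = \<tau>s" "\<And>vs. map tyof vs = \<tau>s \<Longrightarrow> X vs = X' vs" for X X' us
    proof -
      have "interp R M (penv_cons \<tau>s X E) (fsubst (inst us) Q) =
          interp R M' (penv_cons \<tau>s X' E') (fsubst (inst us) Q)"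
        using that by (intro body [OF disjI1 [OF Mu]]) simp_all
      then show ?thesis by (simp add: \<Phi>_def)
    qed
    have "lfp_cand R (\<Phi> M E) ts = lfp_cand R (\<Phi> M' E') ts"
    proof (rule subset_antisym)
      show "lfp_cand R (\<Phi> M E) ts \<subseteq> lfp_cand R (\<Phi> M' E') ts"
        by (rule lfp_cand_mono_typed [OF assms(1) ts _ SN], rule eq [symmetric], assumption, simp)
      show "lfp_cand R (\<Phi> M' E') ts \<subseteq> lfp_cand R (\<Phi> M E) ts"
        by (rule lfp_cand_mono_typed [OF assms(1) ts _ SN], rule eq, assumption, simp)
    qed
    then show ?thesis
      unfolding Mu interp.simps \<Phi>_def .
  next
    case (Nu \<tau>s Q ts)
    then have ts: "map tyof ts = \<tau>s" using wff by simp
    define \<Phi> where "\<Phi> = (\<lambda>M E X us. {\<pi> \<in> SN R. \<forall>\<pi>1 \<pi>2. steps R \<pi> (NuI \<tau>s \<pi>1 \<pi>2) \<longrightarrow>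
      (\<forall>vs. tscong R us vs \<longrightarrow>
        (\<exists>Y. pred_candidate R Y \<and>
           (\<forall>ws. map tyof ws = \<tau>s \<longrightarrow> (\<forall>\<pi>' \<in> Y ws. NuI \<tau>s \<pi>' \<pi>2 \<in> X ws)) \<and>
           pf_inst vs \<pi>1 \<pi>2 \<in> interp R M (penv_cons \<tau>s Y E) (fsubst (inst vs) Q)))})"
    have cand: "candidate R (\<Phi> M E X us)" for M E X us
      unfolding \<Phi>_def by (rule candidate_intro_clauses)
    have eq: "\<Phi> M E X us = \<Phi> M' E' X' us"
      if us: "map tyof us = \<tau>s" and X: "\<And>vs. map tyof vs = \<tau>s \<Longrightarrow> X vs = X' vs" for X X' us
    proof -
      \<comment> \<open>The clause for \<open>Nu\<close> evaluates the body at tuples congruent to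
        \<open>us\<close>; they have the same types, so \<open>body\<close> covers them.\<close>
      have "interp R M (penv_cons \<tau>s Y E) (fsubst (inst vs) Q) =
          interp R M' (penv_cons \<tau>s Y E') (fsubst (inst vs) Q)" if "tscong R us vs" for Y vs
        using that us tscong_tyof [OF assms(1)] by (intro body [OF disjI2 [OF Nu]]) simp_all
      then show ?thesis
        unfolding \<Phi>_def using X by simp
    qed
    have "gfp_cand R (\<Phi> M E) ts = gfp_cand R (\<Phi> M' E') ts"
    proof (rule subset_antisym)
      show "gfp_cand R (\<Phi> M E) ts \<subseteq> gfp_cand R (\<Phi> M' E') ts"
        by (rule gfp_cand_mono_typed [OF assms(1) ts _ cand], rule eq [symmetric], assumption, simp)
      show "gfp_cand R (\<Phi> M' E') ts \<subseteq> gfp_cand R (\<Phi> M E) ts"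
        by (rule gfp_cand_mono_typed [OF assms(1) ts _ cand], rule eq, assumption, simp)
    qed
    then show ?thesis
      unfolding Nu interp.simps \<Phi>_def .
  next
    case (PVar \<sigma>s k ts)
    then show ?thesis using wff pvars by simp
  next
    case (Atom a ts)
    then show ?thesis using atoms [of a ts] by (simp add: may_occur_in_self)
  qed simp_all
qed

text \<open>Induction on the derivation, for all instances and environments: binders are interpreted
  through instances of the body, and fixed points also extend the environment. Since
  \<open>atoms\<close> covers all tuples, the middle formula of a transitivity step needs no typing
  argument.\<close>

lemma interp_fcong:
  assumes "wf_trules R"
    and atoms: "\<And>a ts us. tscong R ts us \<Longrightarrow> M a ts = M a us"
    and rules: "\<And>a ts B \<theta> E. (a, ts, B) \<in> A \<Longrightarrow> (\<And>\<sigma>s k. pred_candidate R (E \<sigma>s k)) \<Longrightarrow>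
      M a (map (subst \<theta>) ts) = interp R M E (fsubst \<theta> B)"
    and "fcong R A P Q"
    and "\<And>\<sigma>s k. pred_candidate R (E \<sigma>s k)"
  shows "interp R M E (fsubst \<theta> P) = interp R M E (fsubst \<theta> Q)"
  using assms(4-)
proof (induction arbitrary: \<theta> E rule: fcong.induct)
  case (fcong_rule a ts B \<eta>)
  then show ?case
    using rules [of a ts B E "scomp \<eta> \<theta>"] by (simp add: fsubst_fsubst subst_subst comp_def)
next
  case (fcong_Mu P P' ts ts' \<tau>s)
  have cons: "pred_candidate R (penv_cons \<tau>s X E \<sigma>s k)" if "pred_candidate R X" for X \<sigma>s k
    using that fcong_Mu.prems by (simp add: penv_cons_def split: nat.split)
  show ?case
    unfolding fsubst.simps interp.simps
  proof (rule lfp_cand_cong)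
    show "tscong R (map (subst \<theta>) ts) (map (subst \<theta>) ts')"
      using assms(1) fcong_Mu.hyps(2) by (rule tscong_subst)
  qed (simp add: fsubst_fsubst fcong_Mu.IH [OF cons])
next
  case (fcong_Nu P P' ts ts' \<tau>s)
  have cons: "pred_candidate R (penv_cons \<tau>s X E \<sigma>s k)" if "pred_candidate R X" for X \<sigma>s k
    using that fcong_Nu.prems by (simp add: penv_cons_def split: nat.split)
  show ?case
    unfolding fsubst.simps interp.simps
  proof (rule gfp_cand_cong)
    show "tscong R (map (subst \<theta>) ts) (map (subst \<theta>) ts')"
      using assms(1) fcong_Nu.hyps(2) by (rule tscong_subst)
  qed (simp add: fsubst_fsubst fcong_Nu.IH [OF cons] cong: conj_cong)
next
  case (fcong_PVar ts ts' \<tau>s k)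
  then show ?case
    using pred_candidate_cong tscong_subst [OF assms(1)] by (metis fsubst.simps(11) interp.simps(11))
next
  case (fcong_Atom ts ts' a)
  then show ?case
    using atoms tscong_subst [OF assms(1)] by (metis fsubst.simps(12) interp.simps(12))
qed (auto simp: fsubst_fsubst)

section \<open>The extended pre-model\<close>

text \<open>\<open>prec_cong\<close> makes \<open>\<prec>\<close> a relation on congruence classes
  of atoms: an atom will be unfolded whenever it is congruent to an instance of a left-hand side,
  while \<open>prec_rule\<close> speaks of the instances themselves.\<close>

locale definitional_extension =
  fixes R :: "'c::term_signature trules"
    and A N :: "('c, 'p) arules"
    and L K :: "'p lang"
    and M :: "'p \<Rightarrow> ('c, 'p) pred"
    and prec :: "'p \<times> 'c tm list \<Rightarrow> 'p \<times> 'c tm list \<Rightarrow> bool"  (infix "\<prec>" 50)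
  assumes wf_R: "wf_trules R" and wf_A: "wf_arules L L A"
    and premodel_M: "premodel_of R A L M"
    and disjoint: "dom K \<inter> dom L = {}"
    and wf_N: "wf_arules K (L ++ K) N"
    and confluent: "\<And>a ts B ts' B' \<theta> \<theta>'. (a, ts, B) \<in> N \<Longrightarrow> (a, ts', B') \<in> N \<Longrightarrow>
           fcong R A (fsubst \<theta> (Atom a ts)) (fsubst \<theta>' (Atom a ts')) \<Longrightarrow>
           fcong R A (fsubst \<theta> B) (fsubst \<theta>' B')"
    and wf_prec: "wfp (\<prec>)"
    and prec_cong: "\<And>a ts b us a' ts' b' us'. (a, ts) \<prec> (b, us) \<Longrightarrow>
           fcong R A (Atom a ts) (Atom a' ts') \<Longrightarrow> fcong R A (Atom b us) (Atom b' us') \<Longrightarrow>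
           (a', ts') \<prec> (b', us')"
    and prec_rule: "\<And>a ts B \<theta> b us. (a, ts, B) \<in> N \<Longrightarrow> b \<in> dom K \<Longrightarrow>
           may_occur_in (Atom b us) (fsubst \<theta> B) \<Longrightarrow> (b, us) \<prec> (a, map (subst \<theta>) ts)"
begin

text \<open>Matching is modulo the old congruence, so congruent atoms have literally the same set
  and hence the same chosen member. By \<open>confluent\<close> any two members are
  congruent.\<close>

definition unfoldings :: "'p \<Rightarrow> 'c tm list \<Rightarrow> ('c, 'p) fm set" where
  "unfoldings a ts = {fsubst \<theta> B | \<theta> B us.
     (a, us, B) \<in> N \<and> fcong R A (Atom a ts) (Atom a (map (subst \<theta>) us))}"

text \<open>The values of the given pre-model at ill-typed atoms are unconstrained, and need be neither
  candidates nor invariant under the congruence; they are replaced.\<close>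

definition base :: "'p \<Rightarrow> ('c, 'p) pred" where
  "base a ts = (if L a = Some (map tyof ts) then M a ts else SN R)"

text \<open>The recursive calls sit inside \<open>interp\<close>, so \<open>wfrec\<close> first cuts
  \<open>g\<close> to smaller atoms; \<open>model_unfold\<close> removes the cut. The environment is
  a dummy, as the chosen formula is closed.\<close>

definition rec :: "'p \<times> 'c tm list \<Rightarrow> ('c, 'p) pf set" where
  "rec = wfrec {(x, y). x \<prec> y} (\<lambda>g (a, ts).
     if unfoldings a ts = {} then SN R
     else interp R (\<lambda>b us. if b \<in> dom K then g (b, us) else base b us) (\<lambda>_ _ _. SN R)
       (SOME P. P \<in> unfoldings a ts))"

definition model :: "'p \<Rightarrow> ('c, 'p) pred" where
  "model a ts = (if a \<in> dom K then rec (a, ts) else base a ts)"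

section \<open>Properties of unfoldings\<close>

lemma unfoldings_cong:
  assumes "tscong R ts us"
  shows "unfoldings a ts = unfoldings a us"
proof -
  have "fcong R A (Atom a ts) Q \<longleftrightarrow> fcong R A (Atom a us) Q" for Q :: "('c, 'p) fm"
    using fcong_Atom [OF assms, of A a] by (blast intro: fcong_sym fcong_trans)
  then show ?thesis by (simp add: unfoldings_def)
qed

lemma unfoldings_wff: "P \<in> unfoldings a ts \<Longrightarrow> wff (L ++ K) P"
  using wf_N by (fastforce simp: unfoldings_def wf_arules_def)

lemma unfoldings_closed: "P \<in> unfoldings a ts \<Longrightarrow> \<not> pvar_occurs \<sigma>s k P"
  using wf_N by (fastforce simp: unfoldings_def wf_arules_def no_free_pvars_def)

lemma unfoldings_prec:
  assumes "P \<in> unfoldings a ts" and "b \<in> dom K" and "may_occur_in (Atom b us) P"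
  shows "(b, us) \<prec> (a, ts)"
proof -
  from assms(1) obtain \<theta> B vs where P: "P = fsubst \<theta> B" "(a, vs, B) \<in> N"
    and "fcong R A (Atom a ts) (Atom a (map (subst \<theta>) vs))"
    by (auto simp: unfoldings_def)
  moreover have "(b, us) \<prec> (a, map (subst \<theta>) vs)"
    using assms P by (blast intro: prec_rule)
  ultimately show ?thesis
    by (blast intro: prec_cong fcong_refl fcong_sym)
qed

text \<open>The cut of the well-founded recursion disappears by \<open>interp_cong\<close>: every
  new atom that may occur in the chosen formula is below \<open>(a, ts)\<close>.\<close>

lemma model_unfold:
  assumes "a \<in> dom K"
  shows "model a ts = (if unfoldings a ts = {} then SN R
    else interp R model (\<lambda>_ _ _. SN R) (SOME P. P \<in> unfoldings a ts))"
proof (cases "unfoldings a ts = {}")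
  case True
  then show ?thesis
    using assms def_wfrec [OF rec_def [THEN eq_reflection], of "(a, ts)"] wf_prec
    by (simp add: model_def wfp_def)
next
  case False
  define P where "P = (SOME P. P \<in> unfoldings a ts)"
  have P: "P \<in> unfoldings a ts"
    using False unfolding P_def by (simp add: some_in_eq)
  let ?M = "\<lambda>b us. if b \<in> dom K then cut rec {(x, y). x \<prec> y} (a, ts) (b, us) else base b us"
  have "model a ts = interp R ?M (\<lambda>_ _ _. SN R) P"
    using False assms def_wfrec [OF rec_def [THEN eq_reflection], of "(a, ts)"] wf_prec
    by (simp add: model_def wfp_def P_def)
  also have "\<dots> = interp R model (\<lambda>_ _ _. SN R) P"
  proof (rule interp_cong [OF wf_R unfoldings_wff [OF P]])
    show "?M b us = model b us" if "may_occur_in (Atom b us) P" for b us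
      using unfoldings_prec [OF P _ that] by (simp add: model_def cut_def)
  qed simp
  finally show ?thesis
    using False by (simp add: P_def)
qed

section \<open>Invariance of the model and candidacy of its values\<close>

lemma model_base: "L a = Some (map tyof ts) \<Longrightarrow> model a ts = M a ts"
  using disjoint by (auto simp: model_def base_def)

lemma interp_M_fcong:
  assumes "fcong R A P Q" and "wff L P" and "wff L Q" and "\<And>\<sigma>s k. pred_candidate R (E \<sigma>s k)"
  shows "interp R M E P = interp R M E Q"
  using assms premodel_M unfolding premodel_of_def by blast

lemma model_cong:
  assumes "tscong R ts us"
  shows "model a ts = model a us"
proof (cases "a \<in> dom K")
  case True
  then show ?thesis by (simp add: model_unfold unfoldings_cong [OF assms])
next
  case False
  have types: "map tyof ts = map tyof us" using wf_R assms by (rule tscong_tyof)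
  have "M a ts = M a us" if "L a = Some (map tyof ts)"
  proof -
    \<comment> \<open>An atom is interpreted by the value of \<open>M\<close>, so invariance of
      \<open>M\<close> is read off from the pre-model property in one particular
      environment.\<close>
    have "interp R M (\<lambda>_ _ _. SN R) (Atom a ts) = interp R M (\<lambda>_ _ _. SN R) (Atom a us)"
      using that types by (intro interp_M_fcong fcong_Atom assms pred_candidate_SN) simp_all
    then show ?thesis by simp
  qed
  with False types show ?thesis by (simp add: model_def base_def)
qed

text \<open>By \<open>candidate_interp\<close>, the induction hypothesis is called on only when the
  chosen right-hand side is itself an atom with a new constant, and then \<open>\<prec>\<close>
  decreases.\<close>

lemma candidate_model: "candidate R (model a ts)"
  using wf_prec
proof (induction "(a, ts)" arbitrary: a ts rule: wfp_induct_rule)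
  case less
  have base: "candidate R (base b us)" for b us
    using premodel_M by (simp add: base_def premodel_of_def premodel_def candidate_SN)
  show ?case
  proof (cases "a \<in> dom K \<and> unfoldings a ts \<noteq> {}")
    case True
    define P where "P = (SOME P. P \<in> unfoldings a ts)"
    have P: "P \<in> unfoldings a ts"
      using True unfolding P_def by (simp add: some_in_eq)
    have "candidate R (interp R model (\<lambda>_ _ _. SN R) P)"
    proof (rule candidate_interp)
      show "candidate R (model b us)" if "P = Atom b us" for b us
      proof (cases "b \<in> dom K")
        case True
        then have "(b, us) \<prec> (a, ts)"
          using P that may_occur_in_self unfoldings_prec by blast
        then show ?thesis by (rule less)
      next
        case False
        then show ?thesis by (simp add: model_def base)
      qed
    qed (rule pred_candidate_SN)
    then show ?thesis using True by (simp add: model_unfold P_def)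
  next
    case False
    then show ?thesis
      by (cases "a \<in> dom K") (simp_all add: model_unfold candidate_SN, simp add: model_def base)
  qed
qed

section \<open>Validity of the old and the new rules\<close>

lemma model_rule_A:
  assumes "(a, ts, B) \<in> A" and E: "\<And>\<sigma>s k. pred_candidate R (E \<sigma>s k)"
  shows "model a (map (subst \<theta>) ts) = interp R model E (fsubst \<theta> B)"
proof -
  have a: "L a = Some (map tyof ts)" and B: "wff L B"
    using wf_A assms(1) by (auto simp: wf_arules_def)
  \<comment> \<open>The right-hand side is a formula of \<open>L\<close>, so all atoms that may
    occur in it are old and well typed, where the model agrees with \<open>M\<close>.\<close>
  have "interp R model E (fsubst \<theta> B) = interp R M E (fsubst \<theta> B)"
  proof (rule interp_cong [OF wf_R])
    show "wff L (fsubst \<theta> B)" using B by simp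
    show "model b us = M b us" if "may_occur_in (Atom b us) (fsubst \<theta> B)" for b us
      using may_occur_in_wff [OF that, of L] B by (simp add: model_base)
  qed simp
  also have "\<dots> = interp R M E (Atom a (map (subst \<theta>) ts))"
    using a B E by (intro interp_M_fcong fcong_sym [OF fcong_rule] assms(1)) (simp_all add: comp_def)
  also have "\<dots> = model a (map (subst \<theta>) ts)"
    using a by (simp add: model_base comp_def)
  finally show ?thesis by simp
qed

text \<open>The model uses the chosen member of \<open>unfoldings\<close>, which may come from
  another rule; \<open>confluent\<close> makes it congruent to \<open>fsubst \<theta> B\<close>
  under the old rules, which the model already respects.\<close>

lemma model_rule_N:
  assumes "(a, ts, B) \<in> N" and E: "\<And>\<sigma>s k. pred_candidate R (E \<sigma>s k)"
  shows "model a (map (subst \<theta>) ts) = interp R model E (fsubst \<theta> B)"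
proof -
  define P where "P = (SOME P. P \<in> unfoldings a (map (subst \<theta>) ts))"
  have B: "fsubst \<theta> B \<in> unfoldings a (map (subst \<theta>) ts)"
    using assms(1) by (auto simp: unfoldings_def intro: fcong_refl)
  then have P: "P \<in> unfoldings a (map (subst \<theta>) ts)"
    unfolding P_def by (rule someI)
  have "a \<in> dom K"
    using wf_N assms(1) by (auto simp: wf_arules_def)
  then have "model a (map (subst \<theta>) ts) = interp R model (\<lambda>_ _ _. SN R) P"
    using B by (auto simp: model_unfold P_def)
  \<comment> \<open>The dummy environment can be replaced by \<open>E\<close> because
    \<open>P\<close> has no free predicate variables.\<close>
  also have "\<dots> = interp R model E P"
    using unfoldings_closed [OF P] by (intro interp_cong [OF wf_R unfoldings_wff [OF P]]) simp_all
  also have "\<dots> = interp R model E (fsubst \<theta> B)"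
  proof -
    from P obtain \<theta>' B' us where B': "P = fsubst \<theta>' B'" "(a, us, B') \<in> N"
      and "fcong R A (Atom a (map (subst \<theta>) ts)) (Atom a (map (subst \<theta>') us))"
      by (auto simp: unfoldings_def)
    then have "fcong R A (fsubst \<theta> B) P"
      using confluent [OF assms(1) B'(2)] by simp
    then have "interp R model E (fsubst ids (fsubst \<theta> B)) = interp R model E (fsubst ids P)"
      using E model_rule_A by (intro interp_fcong [OF wf_R model_cong, where A = A]) blast+
    then show ?thesis by simp
  qed
  finally show ?thesis .
qed

text \<open>The model is invariant at all atoms and satisfies every rule of \<open>A\<close> and
  \<open>N\<close>, so \<open>interp_fcong\<close> applies to the extended congruence, at the
  identity instance.\<close>

lemma premodel_of_model: "premodel_of R (A \<union> N) (L ++ K) model"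
  unfolding premodel_of_def
proof (intro conjI allI impI)
  show "premodel R (L ++ K) model"
    by (simp add: premodel_def candidate_model)
next
  fix P Q :: "('c, 'p) fm" and E :: "('c, 'p) penv"
  assume "fcong R (A \<union> N) P Q" and "\<forall>\<sigma>s k. pred_candidate R (E \<sigma>s k)"
  then have "interp R model E (fsubst ids P) = interp R model E (fsubst ids Q)"
    using model_rule_A model_rule_N by (intro interp_fcong [OF wf_R model_cong, where A = "A \<union> N"]) blast+
  then show "interp R model E P = interp R model E Q" by simp
qed

end

theorem theorem3:
  fixes R :: "'c::term_signature trules"
    and A N :: "('c, 'p) arules"
    and L K :: "'p lang"
    and M :: "'p \<Rightarrow> ('c, 'p) pred"
    and prec :: "'p \<times> 'c tm list \<Rightarrow> 'p \<times> 'c tm list \<Rightarrow> bool"  (infix "\<prec>" 50)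
  assumes "wf_trules R" and "wf_arules L L A"
    and "premodel_of R A L M"
    and "finite (dom K)" and "dom K \<inter> dom L = {}"
    and "wf_arules K (L ++ K) N"
    and "\<And>a ts B ts' B' \<theta> \<theta>'. (a, ts, B) \<in> N \<Longrightarrow> (a, ts', B') \<in> N \<Longrightarrow>
           fcong R A (fsubst \<theta> (Atom a ts)) (fsubst \<theta>' (Atom a ts')) \<Longrightarrow>
           fcong R A (fsubst \<theta> B) (fsubst \<theta>' B')"
    and "wfp (\<prec>)" and "transp (\<prec>)"
    and "\<And>a ts b us a' ts' b' us'. (a, ts) \<prec> (b, us) \<Longrightarrow>
           fcong R A (Atom a ts) (Atom a' ts') \<Longrightarrow> fcong R A (Atom b us) (Atom b' us') \<Longrightarrow>
           (a', ts') \<prec> (b', us')"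
    and "\<And>a ts B \<theta> b us. (a, ts, B) \<in> N \<Longrightarrow> b \<in> dom K \<Longrightarrow>
           may_occur_in (Atom b us) (fsubst \<theta> B) \<Longrightarrow> (b, us) \<prec> (a, map (subst \<theta>) ts)"
  shows "\<exists>M'. premodel_of R (A \<union> N) (L ++ K) M'"
proof -
  interpret definitional_extension R A N L K M prec
    by unfold_locales (fact assms)+
  show ?thesis using premodel_of_model by blast
qed

end
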